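(* For any positive even integer $n$ and any positive integers $d$ and $r$, if $f_{n,d}$ is uniformly chosen from $\mathrm{Hom}(T_{n,d},0)$, then $$\mathbb{P}\big(|\mathrm{Rng}(f_{n,d})|\ge3+r\big)\le\binom{n}{r}^2 2^{-(2d-1)r}\quad\text{and}\quad\mathbb{P}\big(|\mathrm{Rng}(f_{n,d})|<3\big)\le2^{1-n/2}.$$ Thus, if $d(n)$ are positive integers with $d(n)-\log_2 n\to\infty$ as $n\to\infty$ ($n$ even), then $\mathbb{P}\big(|\mathrm{Rng}(f_{n,d(n)})|=3\big)\to1$ as $n\to\infty$ ($n$ even).
   Context: For $n\ge1$ even and $d\ge1$, $T_{n,d}$ is the graph with vertex set $\{0,1,\dots,n-1\}$ in which $i,j$ are adjacent iff $\min\{|i-j|,n-|i-j|\}\in\{1,3,\dots,2d+1\}$. $\mathrm{Hom}(T_{n,d},0)$ is the finite set of functions $f\colon\{0,\dots,n-1\}\to\mathbb{Z}$ with $f(0)=0$ and $|f(i)-f(j)|=1$ whenever $i,j$ are adjacent in $T_{n,d}$. $\mathrm{Rng}(f)$ denotes the set of values taken by $f$, and $|\cdot|$ is cardinality. *)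

theory Defs
  imports "HOL-Probability.Probability"
begin

definition torus_vertices :: "nat \<Rightarrow> nat set" where
  "torus_vertices n = {0..<n}"

definition torus_adj :: "nat \<Rightarrow> nat \<Rightarrow> nat \<Rightarrow> nat \<Rightarrow> bool" where
  "torus_adj n d i j \<longleftrightarrow>
     i \<in> torus_vertices n \<and> j \<in> torus_vertices n \<and>
     min \<bar>int i - int j\<bar> (int n - \<bar>int i - int j\<bar>) \<in> {2 * int k + 1 | k. k \<le> d}"

text \<open>Functions on the vertex set are taken to be extensional (\<open>undefined\<close> elsewhere), so that
  each one is represented exactly once and counting is meaningful.\<close>

definition torus_homs :: "nat \<Rightarrow> nat \<Rightarrow> (nat \<Rightarrow> int) set" where
  "torus_homs n d =
     {f \<in> torus_vertices n \<rightarrow>\<^sub>E UNIV.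
        f 0 = 0 \<and> (\<forall>i j. torus_adj n d i j \<longrightarrow> \<bar>f i - f j\<bar> = 1)}"

definition Rng :: "nat \<Rightarrow> (nat \<Rightarrow> int) \<Rightarrow> int set" where
  "Rng n f = f ` torus_vertices n"

text \<open>\<open>pmf_of_set\<close> is the uniform distribution only on finite nonempty sets; the lemmas
  \<open>finite_torus_homs\<close> and \<open>torus_homs_nonempty\<close> show that this is the case for all positive
  even \<open>n\<close>.\<close>

definition uniform_hom :: "nat \<Rightarrow> nat \<Rightarrow> (nat \<Rightarrow> int) pmf" where
  "uniform_hom n d = pmf_of_set (torus_homs n d)"

lemma torus_adj_Suc:
  assumes "Suc i < n"
  shows "torus_adj n d i (Suc i)"
proof -
  have "min \<bar>int i - int (Suc i)\<bar> (int n - \<bar>int i - int (Suc i)\<bar>) = 2 * int 0 + 1"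
    using assms by simp
  then show ?thesis
    unfolding torus_adj_def torus_vertices_def using assms by (auto intro!: exI[of _ 0])
qed

lemma torus_hom_bounded:
  assumes "f \<in> torus_homs n d" "i < n"
  shows "\<bar>f i\<bar> \<le> int i"
  using assms(2)
proof (induction i)
  case 0
  then show ?case using assms(1) by (simp add: torus_homs_def)
next
  case (Suc i)
  then have "\<bar>f i - f (Suc i)\<bar> = 1"
    using assms(1) torus_adj_Suc[of i n d] by (auto simp: torus_homs_def)
  with Suc show ?case by linarith
qed

lemma finite_torus_homs: "finite (torus_homs n d)"
proof (rule finite_subset)
  show "torus_homs n d \<subseteq> {0..<n} \<rightarrow>\<^sub>E {- int n..int n}"
  proof
    fix f assume f: "f \<in> torus_homs n d"
    have "f i \<in> {- int n..int n}" if "i \<in> {0..<n}" for i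
      using torus_hom_bounded[OF f, of i] that by (simp add: abs_le_iff)
    with f show "f \<in> {0..<n} \<rightarrow>\<^sub>E {- int n..int n}"
      by (auto simp: torus_homs_def torus_vertices_def PiE_iff)
  qed
qed (rule finite_PiE, simp_all)

lemma torus_adj_parity:
  assumes "even n" "torus_adj n d i j"
  shows "even i \<longleftrightarrow> odd j"
proof -
  obtain k where k: "min \<bar>int i - int j\<bar> (int n - \<bar>int i - int j\<bar>) = 2 * int k + 1"
    using assms(2) by (auto simp: torus_adj_def)
  then consider "\<bar>int i - int j\<bar> = 2 * int k + 1" | "int n - \<bar>int i - int j\<bar> = 2 * int k + 1"
    by (metis min_def)
  then have "odd \<bar>int i - int j\<bar>"
  proof cases
    case 1
    then show ?thesis by simp
  next
    case 2
    then have "\<bar>int i - int j\<bar> = int n - (2 * int k + 1)" by linarith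
    then show ?thesis using assms(1) by simp
  qed
  then show ?thesis by simp
qed

lemma torus_homs_nonempty:
  assumes "n > 0" "even n"
  shows "torus_homs n d \<noteq> {}"
proof -
  define f :: "nat \<Rightarrow> int" where "f = (\<lambda>i\<in>torus_vertices n. if even i then 0 else 1)"
  have "\<bar>f i - f j\<bar> = 1" if "torus_adj n d i j" for i j
  proof -
    have "i \<in> torus_vertices n" "j \<in> torus_vertices n"
      using that by (simp_all add: torus_adj_def)
    with torus_adj_parity[OF assms(2) that] show ?thesis
      by (cases "even i") (simp_all add: f_def)
  qed
  moreover have "f 0 = 0"
    using assms(1) by (simp add: f_def torus_vertices_def)
  ultimately have "f \<in> torus_homs n d"
    by (simp add: torus_homs_def) (simp add: f_def)
  then show ?thesis by blast
qed

end

theory Submission imports Defs "HOL-Real_Asymp.Real_Asymp"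
begin

text \<open>
  A homomorphism is encoded by its \<open>n\<close>-periodic word of \<open>\<plusminus>1\<close> increments, and a position \<open>k\<close> is a mark if
  the letters \<open>k\<close> and \<open>k + 1\<close> agree. The edges of length \<open>1, 3, \<dots>, 2d + 1\<close> say exactly that two marks
  at distance less than \<open>2d\<close> have the same parity. Hence the word after the last mark \<open>q\<close> of
  one parity before a mark of the other parity is forced to begin with \<open>(+-)\<^sup>d+\<close> (an up turn) or \<open>(-+)\<^sup>d-\<close>
  (a down turn). If the range has at least \<open>3 + r\<close> elements, each of the \<open>r\<close> four-element intervals of
  consecutive heights is crossed upwards and downwards, which gives \<open>r\<close> up turns and \<open>r\<close> down turns.

  Given the positions of the turns, replace \<open>(+-)\<^sup>d+\<close> by \<open>d\<close> arbitrary blocks from \<open>{+-, -+}\<close>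
  at an up turn, and \<open>(-+)\<^sup>d-\<close> by \<open>d + 1\<close> such blocks at a down turn. One letter is lost and one is
  gained, so the result is again a word of length \<open>n\<close> with sum \<open>0\<close>; the marks created keep the parity
  rule, because the part of the word between the two turns is shifted by one. The old word can be
  recovered, so each pair of turns costs a factor \<open>2\<^bsup>2d+1\<^esup>\<close>, and there are at most
  \<open>(n choose r)\<^sup>2\<close> choices of positions.
\<close>

section \<open>Step words and turns\<close>

definition mark :: "(int \<Rightarrow> int) \<Rightarrow> int \<Rightarrow> bool" where
  "mark x k \<longleftrightarrow> x k = x (k + 1)"

text \<open>Words are indexed by all integers, so that a window around a position never has to be
  split at the end of the period. The zero sum lets the heights close up around the cycle.\<close>

definition step_words :: "nat \<Rightarrow> nat \<Rightarrow> (int \<Rightarrow> int) set" where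
  "step_words n d = {x. (\<forall>k. x k = 1 \<or> x k = -1) \<and> (\<forall>k. x (k + int n) = x k) \<and>
     (\<Sum>k\<in>{0..<int n}. x k) = 0 \<and>
     (\<forall>k k'. mark x k \<and> mark x k' \<and> k < k' \<and> k' < k + 2 * int d \<longrightarrow> even (k' - k))}"

definition turn :: "(int \<Rightarrow> int) \<Rightarrow> int \<Rightarrow> int \<Rightarrow> bool" where
  "turn x s p \<longleftrightarrow> x p = s \<and> x (p + 1) = s \<and>
     (\<exists>p'>p. odd (p' - p) \<and> mark x p' \<and> (\<forall>k. p < k \<and> k < p' \<longrightarrow> \<not> mark x k))"

text \<open>Rewriting one pair of turns may destroy the marks at another turn that touches it. A slot is
  the part of the notion of a turn that survives and that still suffices for the rewriting.\<close>

definition slot :: "nat \<Rightarrow> (int \<Rightarrow> int) \<Rightarrow> int \<Rightarrow> int \<Rightarrow> bool" where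
  "slot d x s q \<longleftrightarrow> x (q + 1) = s \<and>
     (\<forall>k. q < k \<and> k \<le> q + 2 * int d \<longrightarrow> \<not> mark x k) \<and>
     (\<forall>k. q - 2 * int d < k \<and> k \<le> q \<and> mark x k \<longrightarrow> even (k - q)) \<and>
     (\<forall>k. q + 2 * int d < k \<and> k \<le> q + 4 * int d \<and> mark x k \<longrightarrow> odd (k - q))"

text \<open>Describes how far a later mark \<open>q'\<close> is from a turn \<open>q\<close>. If
  \<open>q'\<close> has the parity of \<open>q\<close>, a mark of the other parity lies between them
  and both gaps exceed \<open>2 * d\<close>, hence the bound \<open>4 * d\<close>.\<close>

definition apart :: "nat \<Rightarrow> int \<Rightarrow> int \<Rightarrow> bool" where
  "apart d q q' \<longleftrightarrow> 2 * int d < q' - q \<and> (odd (q' - q) \<or> 4 * int d < q' - q)"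

text \<open>All pairs are compared modulo \<open>n\<close>; the case \<open>q = q'\<close> bounds \<open>n\<close> from below.\<close>

definition spread :: "nat \<Rightarrow> nat \<Rightarrow> int set \<Rightarrow> bool" where
  "spread n d S \<longleftrightarrow> (\<forall>q\<in>S. \<forall>q'\<in>S. \<forall>c. q < q' + c * int n \<longrightarrow> apart d q (q' + c * int n))"

definition slotted :: "nat \<Rightarrow> nat \<Rightarrow> int set \<Rightarrow> int set \<Rightarrow> (int \<Rightarrow> int) set" where
  "slotted n d U V = {x \<in> step_words n d. (\<forall>q\<in>U. slot d x 1 q) \<and> (\<forall>q\<in>V. slot d x (-1) q)}"

section \<open>Periodic sequences\<close>

lemma periodic_mult:
  fixes x :: "int \<Rightarrow> int"
  assumes "\<forall>k. x (k + N) = x k"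
  shows "x (k + c * N) = x k"
proof -
  have nat: "x (k + int m * N) = x k" for k m
  proof (induction m)
    case (Suc m)
    have "x (k + int (Suc m) * N) = x ((k + int m * N) + N)" by (simp add: algebra_simps)
    then show ?case using assms Suc by metis
  qed simp
  show ?thesis
  proof (cases "c \<ge> 0")
    case True
    then show ?thesis using nat[of k "nat c"] by simp
  next
    case False
    then show ?thesis using nat[of "k + c * N" "nat (- c)"] by (simp add: algebra_simps)
  qed
qed

lemma periodic_sum_shift:
  fixes x :: "int \<Rightarrow> int"
  assumes "\<forall>k. x (k + int n) = x k"
  shows "(\<Sum>k\<in>{a..<a + int n}. x k) = (\<Sum>k\<in>{0..<int n}. x k)"
proof -
  have step: "(\<Sum>k\<in>{a + 1..<a + 1 + int n}. x k) = (\<Sum>k\<in>{a..<a + int n}. x k)" for a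
  proof (cases "n = 0")
    case False
    then have "{a + 1..<a + 1 + int n} = insert (a + int n) {a + 1..<a + int n}"
      "{a..<a + int n} = insert a {a + 1..<a + int n}" by auto
    then show ?thesis using assms by simp
  qed simp
  show ?thesis
  proof (induction a rule: int_induct[where k = 0])
    case (step1 i)
    then show ?case using step[of i] by simp
  next
    case (step2 i)
    then show ?case using step[of "i - 1"] by simp
  qed simp
qed

lemma sum_cancelling_pairs:
  fixes x :: "int \<Rightarrow> int"
  assumes "\<And>i. i < m \<Longrightarrow> x (a + 2 * int i) + x (a + 2 * int i + 1) = 0"
  shows "(\<Sum>k\<in>{a..<a + 2 * int m}. x k) = 0"
  using assms
proof (induction m)
  case (Suc m)
  have "{a..<a + 2 * int (Suc m)} =
      insert (a + 2 * int m) (insert (a + 2 * int m + 1) {a..<a + 2 * int m})" by auto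
  then show ?case using Suc.IH Suc.prems[of m] Suc.prems by simp
qed simp

lemma sum_int_split:
  fixes x :: "int \<Rightarrow> int"
  assumes "a \<le> b" "b \<le> c"
  shows "(\<Sum>k\<in>{a..<c}. x k) = (\<Sum>k\<in>{a..<b}. x k) + (\<Sum>k\<in>{b..<c}. x k)"
proof -
  have "{a..<c} = {a..<b} \<union> {b..<c}" using assms by auto
  then show ?thesis by (simp add: sum.union_disjoint)
qed

lemma sum_int_shift:
  fixes x :: "int \<Rightarrow> int"
  shows "(\<Sum>k\<in>{a..<b}. x (k + c)) = (\<Sum>k\<in>{a + c..<b + c}. x k)"
  by (rule sum.reindex_bij_witness[of _ "\<lambda>k. k - c" "\<lambda>k. k + c"]) auto

lemma mark_periodic:
  assumes "\<forall>k. x (k + N) = x k"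
  shows "mark x (k + c * N) = mark x k"
  using periodic_mult[OF assms, of k c] periodic_mult[OF assms, of "k + 1" c]
  by (simp add: mark_def algebra_simps)

lemma slot_periodic:
  assumes "\<forall>k. x (k + int n) = x k" "slot d x s q"
  shows "slot d x s (q + c * int n)"
proof -
  let ?t = "c * int n"
  have m: "mark x k = mark x (k - ?t)" for k
    using mark_periodic[OF assms(1), of "k - ?t" c] by simp
  show ?thesis
    unfolding slot_def
  proof (intro conjI allI impI)
    show "x (q + ?t + 1) = s"
      using assms(2) periodic_mult[OF assms(1), of "q + 1" c] by (simp add: slot_def algebra_simps)
  next
    fix k assume "q + ?t < k \<and> k \<le> q + ?t + 2 * int d"
    then show "\<not> mark x k" unfolding m[of k] using assms(2) by (auto simp: slot_def)
  next
    fix k assume k: "q + ?t - 2 * int d < k \<and> k \<le> q + ?t \<and> mark x k"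
    then have "even (k - ?t - q)"
      using assms(2) unfolding m[of k] slot_def
      by (metis diff_le_eq diff_less_eq less_diff_eq add_diff_eq diff_add_eq)
    moreover have "k - (q + ?t) = k - ?t - q" by simp
    ultimately show "even (k - (q + ?t))" by metis
  next
    fix k assume k: "q + ?t + 2 * int d < k \<and> k \<le> q + ?t + 4 * int d \<and> mark x k"
    then have "q + 2 * int d < k - ?t \<and> k - ?t \<le> q + 4 * int d \<and> mark x (k - ?t)"
      unfolding m[of k, symmetric] by auto
    then have "odd (k - ?t - q)"
      using assms(2) unfolding slot_def by blast
    moreover have "k - (q + ?t) = k - ?t - q" by simp
    ultimately show "odd (k - (q + ?t))" by metis
  qed
qed

text \<open>Letters alternate where there are no marks. So the \<open>2 * d + 1\<close> letters that
  the rewriting overwrites are known from the slot alone.\<close>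

lemma slot_letters:
  assumes "\<forall>k. x k = 1 \<or> x k = -1" "slot d x s q" "1 \<le> t" "t \<le> 2 * int d + 1"
  shows "x (q + t) = (if odd t then s else - s)"
  using assms(3,4)
proof (induction t rule: int_ge_induct)
  case base
  then show ?case using assms(2) by (simp add: slot_def)
next
  case (step i)
  then have "\<not> mark x (q + i)" using assms(2) by (simp add: slot_def)
  moreover have "x (q + i) = (if odd i then s else - s)" using step by simp
  ultimately show ?case
    using assms(1)[rule_format, of "q + i"] assms(1)[rule_format, of "q + i + 1"]
    by (auto simp: mark_def add.assoc split: if_splits)
qed

section \<open>Rewriting an up turn and a down turn\<close>

text \<open>Bit \<open>j \<in> b\<close> selects the block \<open>+-\<close> at the letters \<open>2 * j\<close> and \<open>2 * j + 1\<close>.\<close>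

definition block_letter :: "int set \<Rightarrow> int \<Rightarrow> int" where
  "block_letter b i = (if i div 2 \<in> b then 1 else -1) * (if even i then 1 else -1)"

lemma block_letter_pair: "even i \<Longrightarrow> block_letter b (i + 1) = - block_letter b i"
  by (auto simp: block_letter_def)

lemma block_letter_cases: "block_letter b i = 1 \<or> block_letter b i = -1"
  by (auto simp: block_letter_def)

text \<open>The up slot is \<open>u\<close> and the down slot is \<open>u + e\<close>. Offsets \<open>t\<close> from \<open>u\<close> run over \<open>1, \<dots>, n\<close>: blocks
  \<open>0, \<dots>, d - 1\<close>, then the old word shifted left by one, then blocks \<open>d, \<dots>, 2d\<close>, then the old word.\<close>

definition rewrite_word ::
    "nat \<Rightarrow> nat \<Rightarrow> int \<Rightarrow> int \<Rightarrow> (int \<Rightarrow> int) \<Rightarrow> int set \<Rightarrow> int \<Rightarrow> int" where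
  "rewrite_word n d u e x b k =
     (let t = (k - u - 1) mod int n + 1 in
      if t \<le> 2 * int d then block_letter b (t - 1)
      else if t < e then x (u + t + 1)
      else if t \<le> e + 2 * int d + 1 then block_letter b (t - e + 2 * int d)
      else x (u + t))"

text \<open>\<open>apart1\<close> and \<open>apart2\<close> control the two arcs of the cycle
  between the up slot and the down slot. Of the arbitrary set \<open>b\<close>, only the elements
  from \<open>0\<close> to \<open>2 * d\<close> influence the new word.\<close>

locale rewriting =
  fixes n d :: nat and u e :: int and x :: "int \<Rightarrow> int" and b :: "int set"
  assumes n: "n > 0" "even n"
    and x: "x \<in> step_words n d"
    and up: "slot d x 1 u" and down: "slot d x (-1) (u + e)"
    and apart1: "apart d u (u + e)" and apart2: "apart d (u + e) (u + int n)"
begin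

abbreviation "g \<equiv> rewrite_word n d u e x b"

lemma bounds: "0 < e" "2 * int d < e" "e + 2 * int d < int n"
  using apart1 apart2 by (auto simp: apart_def)

lemma x_cases: "x k = 1 \<or> x k = -1" and x_per: "x (k + int n) = x k"
  and x_marks: "mark x k \<Longrightarrow> mark x k' \<Longrightarrow> k < k' \<Longrightarrow> k' < k + 2 * int d \<Longrightarrow> even (k' - k)"
  and x_sum: "(\<Sum>k\<in>{0..<int n}. x k) = 0"
  using x by (auto simp: step_words_def)

lemma g_periodic: "g (k + int n) = g k"
proof -
  have "(k + int n - u - 1) mod int n = (k - u - 1) mod int n"
    by (metis add_diff_eq diff_add_eq mod_add_self2)
  then show ?thesis by (simp add: rewrite_word_def)
qed

lemma g_cases: "g k = 1 \<or> g k = -1"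
  using x_cases block_letter_cases by (simp add: rewrite_word_def Let_def)

lemma g_at: "1 \<le> t \<Longrightarrow> t \<le> int n \<Longrightarrow>
   g (u + t) = (if t \<le> 2 * int d then block_letter b (t - 1)
      else if t < e then x (u + t + 1)
      else if t \<le> e + 2 * int d + 1 then block_letter b (t - e + 2 * int d)
      else x (u + t))"
  by (simp add: rewrite_word_def Let_def)

section \<open>Marks of the rewritten word, zone by zone\<close>

lemma g_zone1: "1 \<le> t \<Longrightarrow> t \<le> 2 * int d \<Longrightarrow> g (u + t) = block_letter b (t - 1)"
  using bounds by (simp add: g_at)
lemma g_shifted: "2 * int d < t \<Longrightarrow> t < e \<Longrightarrow> g (u + t) = x (u + t + 1)"
  using bounds by (simp add: g_at)
lemma g_zone2: "e \<le> t \<Longrightarrow> t \<le> e + 2 * int d + 1 \<Longrightarrow>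
    g (u + t) = block_letter b (t - e + 2 * int d)"
  using bounds by (simp add: g_at)
lemma g_same: "e + 2 * int d + 1 < t \<Longrightarrow> t \<le> int n \<Longrightarrow> g (u + t) = x (u + t)"
  using bounds by (simp add: g_at)

text \<open>For odd \<open>t\<close> strictly inside the zone, the letters at offsets
  \<open>t\<close> and \<open>t + 1\<close> form one block and differ. The borders \<open>0\<close>
  and \<open>2 * d\<close>, where a block meets a letter from outside, are even.\<close>

lemma marks_zone1: "mark g (u + t) \<Longrightarrow> 0 \<le> t \<Longrightarrow> t \<le> 2 * int d \<Longrightarrow> even t"
proof (rule ccontr)
  assume a: "mark g (u + t)" "0 \<le> t" "t \<le> 2 * int d" "odd t"
  then have "1 \<le> t" "t + 1 \<le> 2 * int d" by presburger+
  then have "g (u + t) = block_letter b (t - 1)" "g (u + (t + 1)) = block_letter b (t - 1 + 1)"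
    by (subst g_zone1; simp)+
  moreover have "block_letter b (t - 1 + 1) = - block_letter b (t - 1)"
    by (rule block_letter_pair) (use a in simp)
  ultimately show False
    using a(1) block_letter_cases[of b "t - 1"] by (auto simp: mark_def add.assoc)
qed

lemma marks_shifted: "2 * int d < t \<Longrightarrow> t < e - 1 \<Longrightarrow> mark g (u + t) = mark x (u + t + 1)"
  using g_shifted[of t] g_shifted[of "t + 1"] by (simp add: mark_def add.assoc)

text \<open>Blocks start at offset \<open>e\<close> here, so a letter at even distance from
  \<open>e\<close> opens a block and differs from its successor. The borders \<open>e - 1\<close>
  and \<open>e + 2 * d + 1\<close> are at odd distance from \<open>e\<close>.\<close>

lemma marks_zone2:
  "mark g (u + t) \<Longrightarrow> e - 1 \<le> t \<Longrightarrow> t \<le> e + 2 * int d + 1 \<Longrightarrow> odd (t - e)"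
proof (rule ccontr)
  assume a: "mark g (u + t)" "e - 1 \<le> t" "t \<le> e + 2 * int d + 1" "\<not> odd (t - e)"
  then have b: "e \<le> t" "t + 1 \<le> e + 2 * int d + 1" by presburger+
  then have "g (u + t) = block_letter b (t - e + 2 * int d)"
    "g (u + (t + 1)) = block_letter b (t - e + 2 * int d + 1)"
    by (subst g_zone2; simp add: algebra_simps)+
  moreover have "block_letter b (t - e + 2 * int d + 1) = - block_letter b (t - e + 2 * int d)"
    by (rule block_letter_pair) (use a in simp)
  ultimately show False
    using a(1) block_letter_cases[of b "t - e + 2 * int d"] by (auto simp: mark_def add.assoc)
qed

lemma marks_same: "e + 2 * int d + 1 < t \<Longrightarrow> t < int n \<Longrightarrow> mark g (u + t) = mark x (u + t)"
  using g_same[of t] g_same[of "t + 1"] by (simp add: mark_def add.assoc)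

lemma marks_next: "mark g (u + t) \<Longrightarrow> int n \<le> t \<Longrightarrow> t \<le> int n + 2 * int d \<Longrightarrow> even t"
proof -
  assume a: "mark g (u + t)" "int n \<le> t" "t \<le> int n + 2 * int d"
  have "mark g (u + (t - int n))"
    using mark_periodic[of g "int n" "u + (t - int n)" 1] g_periodic a(1) by simp
  then have "even (t - int n)" using marks_zone1[of "t - int n"] a by simp
  then show "even t" using n by simp
qed

lemma x_up_left: "mark x (u + t) \<Longrightarrow> - 2 * int d < t \<Longrightarrow> t \<le> 0 \<Longrightarrow> even t"
  using up unfolding slot_def by (elim conjE allE[of _ "u + t"]) simp
lemma x_up_right: "mark x (u + t) \<Longrightarrow> 2 * int d < t \<Longrightarrow> t \<le> 4 * int d \<Longrightarrow> odd t"
  using up unfolding slot_def by (elim conjE allE[of _ "u + t"]) simp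
lemma x_down_left: "mark x (u + t) \<Longrightarrow> e - 2 * int d < t \<Longrightarrow> t \<le> e \<Longrightarrow> even (t - e)"
  using down unfolding slot_def by (elim conjE allE[of _ "u + t"]) (simp add: algebra_simps)
lemma x_down_right:
  "mark x (u + t) \<Longrightarrow> e + 2 * int d < t \<Longrightarrow> t \<le> e + 4 * int d \<Longrightarrow> odd (t - e)"
  using down unfolding slot_def by (elim conjE allE[of _ "u + t"]) (simp add: algebra_simps)
lemma x_next_left: "mark x (u + t) \<Longrightarrow> int n - 2 * int d < t \<Longrightarrow> t \<le> int n \<Longrightarrow> even t"
proof -
  assume a: "mark x (u + t)" "int n - 2 * int d < t" "t \<le> int n"
  have "mark x (u + (t - int n))"
    using mark_periodic[of x "int n" "u + (t - int n)" 1] x_per a(1) by simp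
  then have "even (t - int n)" using x_up_left[of "t - int n"] a by simp
  then show "even t" using n by simp
qed

lemma odd_e: "e \<le> 4 * int d \<Longrightarrow> odd e"
  using apart1 by (auto simp: apart_def)
lemma odd_ne: "int n - e \<le> 4 * int d \<Longrightarrow> odd e"
  using apart2 n by (auto simp: apart_def)

text \<open>Two marks in the same zone obey the rule of that zone or that of \<open>x\<close>. For
  different zones, the windows of the slots give the parity of the old marks nearby: odd after the
  up slot, which the shift by one turns into even offsets as in the first block zone, and even
  relative to \<open>e\<close> before the down slot, which becomes odd as in the second. If both
  block zones are involved, \<open>apart\<close> makes \<open>e\<close> odd, and the two rules
  agree.\<close>

lemma g_marks_aux:
  assumes "mark g (u + t)" "mark g (u + t')" "t < t'" "t' < t + 2 * int d" "0 \<le> t" "t < int n"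
  shows "even (t' - t)"
proof -
  note b = bounds
  consider "t \<le> 2 * int d" | "2 * int d < t" "t < e - 1" |
    "e - 1 \<le> t" "t \<le> e + 2 * int d + 1" | "e + 2 * int d + 1 < t" by linarith
  then show ?thesis
  proof cases
    case 1
    have et: "even t" using marks_zone1 1 assms by blast
    consider "t' \<le> 2 * int d" | "2 * int d < t'" "t' < e - 1" |
      "2 * int d < t'" "e - 1 \<le> t'" by linarith
    then have "even t'"
    proof cases
      case 1
      then show ?thesis using marks_zone1 assms by auto
    next
      case 2
      then have "mark x (u + (t' + 1))" using marks_shifted[of t'] assms by (simp add: add.assoc)
      then have "odd (t' + 1)" using x_up_right[of "t' + 1"] 1 2 assms by linarith
      then show ?thesis by simp
    next
      case 3
      then have "odd (t' - e)" using marks_zone2[of t'] assms 1 b by linarith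
      moreover have "odd e" using odd_e 1 3 assms by linarith
      ultimately show ?thesis by simp
    qed
    then show ?thesis using et by simp
  next
    case 2
    have m: "mark x (u + t + 1)" using marks_shifted 2 assms by blast
    consider "t' < e - 1" | "e - 1 \<le> t'" by linarith
    then show ?thesis
    proof cases
      case 1
      then have "mark x (u + t' + 1)" using marks_shifted[of t'] 2 assms by simp
      then have "even ((u + t' + 1) - (u + t + 1))" by (rule x_marks[OF m]) (use assms in auto)
      then show ?thesis by simp
    next
      case 3: 2
      then have "odd (t' - e)" using marks_zone2[of t'] assms 2 b by linarith
      moreover have "even (t + 1 - e)"
        using x_down_left[of "t + 1"] m 2 3 assms by (simp add: add.assoc)
      ultimately show ?thesis by presburger
    qed
  next
    case 3
    have o: "odd (t - e)" using marks_zone2 3 assms by blast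
    consider "t' \<le> e + 2 * int d + 1" | "e + 2 * int d + 1 < t'" "t' < int n" |
      "e + 2 * int d + 1 < t'" "int n \<le> t'" by linarith
    then have "odd (t' - e)"
    proof cases
      case 1
      then show ?thesis using marks_zone2[of t'] assms 3 by linarith
    next
      case 2
      then have "mark x (u + t')" using marks_same[of t'] assms by simp
      then show ?thesis using x_down_right[of t'] 2 3 assms by simp
    next
      case 4: 3
      then have "even t'" using marks_next[of t'] assms by linarith
      moreover have "odd e" using odd_ne 3 4 assms by linarith
      ultimately show ?thesis by simp
    qed
    then show ?thesis using o by presburger
  next
    case 4
    then have m: "mark x (u + t)" using marks_same assms by blast
    show ?thesis
    proof (cases "t' < int n")
      case True
      then have "mark x (u + t')" using marks_same[of t'] assms 4 by simp
      then have "even ((u + t') - (u + t))" by (rule x_marks[OF m]) (use assms in auto)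
      then show ?thesis by simp
    next
      case False
      then have "even t'" using marks_next[of t'] assms by linarith
      moreover have "even t" using x_next_left[OF m] False assms by linarith
      ultimately show ?thesis by simp
    qed
  qed
qed

lemma g_marks:
  assumes "mark g k" "mark g k'" "k < k'" "k' < k + 2 * int d"
  shows "even (k' - k)"
proof -
  \<comment> \<open>\<open>c\<close> translates \<open>k\<close> into the period that starts at
    \<open>u\<close>.\<close>
  define c where "c = - ((k - u) div int n)"
  have c: "k + c * int n - u = (k - u) mod int n"
    by (simp add: c_def minus_div_mult_eq_mod[symmetric] algebra_simps)
  have "mark g (k + c * int n)" "mark g (k' + c * int n)"
    using assms g_periodic mark_periodic[of g "int n"] by auto
  moreover have "0 \<le> k + c * int n - u" "k + c * int n - u < int n"
    using n by (simp_all add: c)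
  ultimately have "even ((k' + c * int n - u) - (k + c * int n - u))"
    using assms by (intro g_marks_aux) auto
  then show ?thesis by simp
qed

text \<open>The overwritten words have sums \<open>1\<close> and \<open>-1\<close>, which cancel,
  while every block has sum \<open>0\<close>. All other letters are copied, possibly
  shifted.\<close>

lemma g_sum: "(\<Sum>k\<in>{0..<int n}. g k) = 0"
proof -
  note b = bounds
  have per: "\<forall>k. x (k + int n) = x k" "\<forall>k. g (k + int n) = g k"
    using x_per g_periodic by auto
  let ?I = "\<lambda>a b. {u + a..<u + b}"
  have xs: "(\<Sum>k\<in>?I 1 (int n + 1). x k) = 0"
    using periodic_sum_shift[OF per(1), of "u + 1"] x_sum by (simp add: algebra_simps)
  have gs: "(\<Sum>k\<in>?I 1 (int n + 1). g k) = (\<Sum>k\<in>{0..<int n}. g k)"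
    using periodic_sum_shift[OF per(2), of "u + 1"] by (simp add: algebra_simps)
  have zone: "(\<Sum>k\<in>{q + 1..<q + 2 * int d + 2}. x k) = s" if "slot d x s q" for q s
  proof -
    have "{q + 1..<q + 2 * int d + 2} = insert (q + 1) {q + 2..<q + 2 + 2 * int d}" by auto
    moreover have "(\<Sum>k\<in>{q + 2..<q + 2 + 2 * int d}. x k) = 0"
    proof (rule sum_cancelling_pairs)
      fix i assume "i < d"
      then show "x (q + 2 + 2 * int i) + x (q + 2 + 2 * int i + 1) = 0"
        using slot_letters[OF _ that, of "2 + 2 * int i"] slot_letters[OF _ that, of "3 + 2 * int i"]
          x_cases by (auto simp: algebra_simps)
    qed
    moreover have "x (q + 1) = s" using that by (simp add: slot_def)
    ultimately show ?thesis by simp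
  qed
  have x1: "(\<Sum>k\<in>?I 1 (2 * int d + 2). x k) = 1"
    using zone[OF up] by (simp add: algebra_simps)
  have x2: "(\<Sum>k\<in>?I (e + 1) (e + 2 * int d + 2). x k) = - 1"
    using zone[OF down] by (simp add: algebra_simps)
  have xsplit: "(\<Sum>k\<in>?I 1 (int n + 1). x k) = (\<Sum>k\<in>?I 1 (2 * int d + 2). x k)
     + (\<Sum>k\<in>?I (2 * int d + 2) (e + 1). x k) + (\<Sum>k\<in>?I (e + 1) (e + 2 * int d + 2). x k)
     + (\<Sum>k\<in>?I (e + 2 * int d + 2) (int n + 1). x k)"
    using b by (subst sum_int_split[of _ "u + (2 * int d + 2)"], simp, simp,
      subst sum_int_split[of "u + (2 * int d + 2)" "u + (e + 1)"], simp, simp,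
      subst sum_int_split[of "u + (e + 1)" "u + (e + 2 * int d + 2)"], simp, simp, simp)
  have gsplit: "(\<Sum>k\<in>?I 1 (int n + 1). g k) = (\<Sum>k\<in>?I 1 (2 * int d + 1). g k)
     + (\<Sum>k\<in>?I (2 * int d + 1) e. g k) + (\<Sum>k\<in>?I e (e + 2 * int d + 2). g k)
     + (\<Sum>k\<in>?I (e + 2 * int d + 2) (int n + 1). g k)"
    using b by (subst sum_int_split[of _ "u + (2 * int d + 1)"], simp, simp,
      subst sum_int_split[of "u + (2 * int d + 1)" "u + e"], simp, simp,
      subst sum_int_split[of "u + e" "u + (e + 2 * int d + 2)"], simp, simp, simp)
  have g1: "(\<Sum>k\<in>?I 1 (2 * int d + 1). g k) = 0"
  proof -
    have "(\<Sum>k\<in>{u + 1..<u + 1 + 2 * int d}. g k) = 0"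
    proof (rule sum_cancelling_pairs)
      fix i assume "i < d"
      then show "g (u + 1 + 2 * int i) + g (u + 1 + 2 * int i + 1) = 0"
        using g_zone1[of "1 + 2 * int i"] g_zone1[of "2 + 2 * int i"]
          block_letter_pair[of "2 * int i" b] by (simp add: algebra_simps)
    qed
    then show ?thesis by (simp add: algebra_simps)
  qed
  have g2: "(\<Sum>k\<in>?I e (e + 2 * int d + 2). g k) = 0"
  proof -
    have "(\<Sum>k\<in>{u + e..<u + e + 2 * int (Suc d)}. g k) = 0"
    proof (rule sum_cancelling_pairs)
      fix i assume "i < Suc d"
      then show "g (u + e + 2 * int i) + g (u + e + 2 * int i + 1) = 0"
        using g_zone2[of "e + 2 * int i"] g_zone2[of "e + 2 * int i + 1"]
          block_letter_pair[of "2 * int i + 2 * int d" b] by (simp add: algebra_simps)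
    qed
    then show ?thesis by (simp add: algebra_simps)
  qed
  have "(\<Sum>k\<in>?I (2 * int d + 1) e. g k) = (\<Sum>k\<in>?I (2 * int d + 1) e. x (k + 1))"
  proof (rule sum.cong)
    fix k assume "k \<in> ?I (2 * int d + 1) e"
    then show "g k = x (k + 1)" using g_shifted[of "k - u"] by simp
  qed simp
  also have "\<dots> = (\<Sum>k\<in>?I (2 * int d + 2) (e + 1). x k)"
    by (subst sum_int_shift) (simp add: algebra_simps)
  finally have g3: "(\<Sum>k\<in>?I (2 * int d + 1) e. g k) = (\<Sum>k\<in>?I (2 * int d + 2) (e + 1). x k)" .
  have g4: "(\<Sum>k\<in>?I (e + 2 * int d + 2) (int n + 1). g k) =
      (\<Sum>k\<in>?I (e + 2 * int d + 2) (int n + 1). x k)"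
  proof (rule sum.cong)
    fix k assume "k \<in> ?I (e + 2 * int d + 2) (int n + 1)"
    then show "g k = x k" using g_same[of "k - u"] by simp
  qed simp
  show ?thesis using xs gs x1 x2 xsplit gsplit g1 g2 g3 g4 by linarith
qed

lemma g_step_word: "g \<in> step_words n d"
  unfolding step_words_def using g_cases g_periodic g_sum g_marks by blast

text \<open>The hypotheses put the slot on the arc from \<open>u + e\<close> to
  \<open>u + n\<close>, which is copied without a shift. Only its outer windows can reach into
  blocks, and then \<open>apart\<close> makes the distance to \<open>u + e\<close> or to
  \<open>u + n\<close> odd, so that the marks between blocks have the parity the slot asks
  for.\<close>

lemma g_slot:
  assumes "slot d x s (u + q)" "apart d (u + e) (u + q)" "apart d (u + q) (u + int n)"
  shows "slot d g s (u + q)"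
proof -
  note b = bounds
  have q: "2 * int d < q - e" "odd (q - e) \<or> 4 * int d < q - e"
    "2 * int d < int n - q" "odd (int n - q) \<or> 4 * int d < int n - q"
    using assms(2,3) by (auto simp: apart_def)
  have "x (u + q + 1) = s" and
    zone: "\<And>t. q < t \<Longrightarrow> t \<le> q + 2 * int d \<Longrightarrow> \<not> mark x (u + t)" and
    left: "\<And>t. q - 2 * int d < t \<Longrightarrow> t \<le> q \<Longrightarrow> mark x (u + t) \<Longrightarrow> even (t - q)" and
    right: "\<And>t. q + 2 * int d < t \<Longrightarrow> t \<le> q + 4 * int d \<Longrightarrow> mark x (u + t) \<Longrightarrow> odd (t - q)"
  proof -
    show "x (u + q + 1) = s" using assms(1) by (simp add: slot_def)
    show "\<not> mark x (u + t)" if "q < t" "t \<le> q + 2 * int d" for t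
      using that assms(1) unfolding slot_def by (elim conjE allE[of _ "u + t"]) simp
    show "even (t - q)" if "q - 2 * int d < t" "t \<le> q" "mark x (u + t)" for t
      using that assms(1) unfolding slot_def by (elim conjE allE[of _ "u + t"]) simp
    show "odd (t - q)" if "q + 2 * int d < t" "t \<le> q + 4 * int d" "mark x (u + t)" for t
      using that assms(1) unfolding slot_def by (elim conjE allE[of _ "u + t"]) simp
  qed
  \<comment> \<open>Offset \<open>q\<close> itself may be \<open>e + 2 * d + 1\<close>, the last
    letter of a block. This is why a slot prescribes the letter at \<open>q + 1\<close> but not the
    one at \<open>q\<close>.\<close>
  then have 1: "g (u + q + 1) = s" using g_same[of "q + 1"] q by (simp add: add.assoc)
  have 2: "\<not> mark g (u + t)" if "q < t" "t \<le> q + 2 * int d" for t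
    using marks_same[of t] zone[OF that] q that by linarith
  have 3: "even (t - q)" if "q - 2 * int d < t" "t \<le> q" "mark g (u + t)" for t
  proof (cases "t \<le> e + 2 * int d + 1")
    case True
    then have "odd (t - e)" using marks_zone2[of t] that q by linarith
    moreover have "odd (q - e)" using True that q by linarith
    ultimately show ?thesis by presburger
  next
    case False
    then show ?thesis using marks_same[of t] left[of t] that q by linarith
  qed
  have 4: "odd (t - q)" if "q + 2 * int d < t" "t \<le> q + 4 * int d" "mark g (u + t)" for t
  proof (cases "t < int n")
    case True
    then show ?thesis using marks_same[of t] right[of t] that q by linarith
  next
    case False
    then have "even t" using marks_next[of t] that q by linarith
    moreover have "odd (int n - q)" using False that q by linarith
    ultimately show ?thesis using n by presburger
  qed
  show ?thesis
    unfolding slot_def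
  proof (intro conjI allI impI)
    fix k assume "u + q < k \<and> k \<le> u + q + 2 * int d"
    then show "\<not> mark g k" using 2[of "k - u"] by auto
  next
    fix k assume "u + q - 2 * int d < k \<and> k \<le> u + q \<and> mark g k"
    then show "even (k - (u + q))" using 3[of "k - u"] by (auto simp: algebra_simps)
  next
    fix k assume "u + q + 2 * int d < k \<and> k \<le> u + q + 4 * int d \<and> mark g k"
    then show "odd (k - (u + q))" using 4[of "k - u"] by (auto simp: algebra_simps)
  qed (rule 1)
qed

section \<open>Recovering the bits and the old word\<close>

text \<open>\<open>pos j\<close> is the place of the first letter of block \<open>j\<close>, which
  is \<open>1\<close> exactly for the block selected by a bit in \<open>b\<close>.\<close>

lemma bits_from_g:
  assumes "b \<subseteq> {0..<2 * int d + 1}"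
  defines "pos \<equiv> \<lambda>j. if j < int d then u + (2 * j + 1) else u + (e + 2 * (j - int d))"
  shows "b = {j \<in> {0..<2 * int d + 1}. g (pos j) = 1}"
proof -
  have "g (pos j) = 1 \<longleftrightarrow> j \<in> b" if "j \<in> {0..<2 * int d + 1}" for j
    using that g_zone1[of "2 * j + 1"] g_zone2[of "e + 2 * (j - int d)"]
    by (auto simp: block_letter_def pos_def)
  then show ?thesis using assms(1) by blast
qed

text \<open>Overwritten letters are forced by the slots and all others survive in \<open>g\<close>,
  so the right-hand side depends on \<open>x\<close> only through \<open>g\<close>.\<close>

lemma word_from_g:
  assumes "1 \<le> t" "t \<le> int n"
  shows "x (u + t) =
    (if t \<le> 2 * int d + 1 then (if odd t then 1 else - 1)
     else if t \<le> e then g (u + (t - 1))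
     else if t \<le> e + 2 * int d + 1 then (if odd (t - e) then - 1 else 1)
     else g (u + t))"
proof -
  have a: "\<forall>k. x k = 1 \<or> x k = -1" using x_cases by blast
  consider "t \<le> 2 * int d + 1" | "2 * int d + 1 < t" "t \<le> e"
    | "e < t" "t \<le> e + 2 * int d + 1" | "e + 2 * int d + 1 < t" by linarith
  then show ?thesis
  proof cases
    case 1
    then show ?thesis using slot_letters[OF a up, of t] assms by simp
  next
    case 2
    then show ?thesis using g_shifted[of "t - 1"] by simp
  next
    case 3
    then show ?thesis using slot_letters[OF a down, of "t - e"] bounds by simp
  next
    case 4
    then show ?thesis using g_same[of t] assms bounds by simp
  qed
qed

end

section \<open>Counting words with prescribed slots\<close>

lemma finite_step_words:
  assumes "n > 0"
  shows "finite (step_words n d)"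
proof (rule finite_subset)
  show "step_words n d \<subseteq>
      (\<lambda>f k. f (k mod int n)) ` ({0..<int n} \<rightarrow>\<^sub>E {1, -1})"
  proof
    fix x assume x: "x \<in> step_words n d"
    have "x = (\<lambda>k. restrict x {0..<int n} (k mod int n))"
    proof
      fix k
      have "x (k mod int n) = x (k + (- (k div int n)) * int n)"
        by (simp add: minus_div_mult_eq_mod[symmetric])
      also have "\<dots> = x k"
        by (rule periodic_mult) (use x in \<open>simp add: step_words_def\<close>)
      finally show "x k = restrict x {0..<int n} (k mod int n)" using assms by simp
    qed
    moreover have "restrict x {0..<int n} \<in> {0..<int n} \<rightarrow>\<^sub>E {1, -1}"
      using x by (auto simp: step_words_def)
    ultimately show "x \<in> (\<lambda>f k. f (k mod int n)) ` ({0..<int n} \<rightarrow>\<^sub>E {1, -1})" by blast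
  qed
qed (auto intro: finite_PiE)

lemma rewriting_word_unique:
  assumes "rewriting n d u e x" "rewriting n d u e x'"
    and "rewrite_word n d u e x b = rewrite_word n d u e x' b'"
  shows "x = x'"
proof
  fix k
  interpret A: rewriting n d u e x b by (rule assms(1))
  interpret B: rewriting n d u e x' b' by (rule assms(2))
  define t where "t = (k - u - 1) mod int n + 1"
  have t: "1 \<le> t" "t \<le> int n" using A.n by (simp_all add: t_def add1_zle_eq)
  have k: "u + t = k + (- ((k - u - 1) div int n)) * int n"
    by (simp add: t_def minus_div_mult_eq_mod[symmetric] algebra_simps)
  have "x (u + t) = x' (u + t)"
    unfolding A.word_from_g[OF t] B.word_from_g[OF t] assms(3) ..
  moreover have "x (u + t) = x k" "x' (u + t) = x' k"
    unfolding k by (rule periodic_mult, use A.x_per in blast) (rule periodic_mult, use B.x_per in blast)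
  ultimately show "x k = x' k" by simp
qed

lemma apart_cong: "apart d q q' \<Longrightarrow> w' - w = q' - q \<Longrightarrow> apart d w w'"
  by (simp add: apart_def)

lemma mod_representative:
  assumes "n > 0"
  obtains c where "u + (w - u) mod int n = w + c * int n"
proof
  show "u + (w - u) mod int n = w + (- ((w - u) div int n)) * int n"
    by (simp add: minus_div_mult_eq_mod[symmetric] algebra_simps)
qed

text \<open>The pair \<open>u\<close>, \<open>v\<close> is chosen from \<open>U\<close> and
  \<open>V\<close> alone, the same for all words. Rewriting at this pair with any subset of
  \<open>2 * d + 1\<close> bits keeps the remaining slots, and both the word and the bits can be
  read off from the result.\<close>

lemma slotted_remove_pair:
  assumes n: "n > 0" "even n" and U: "U \<subseteq> {0..<int n}" "U \<noteq> {}"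
    and V: "V \<subseteq> {0..<int n}" "V \<noteq> {}" and UV: "U \<inter> V = {}" "spread n d (U \<union> V)"
  obtains u v where "u \<in> U" "v \<in> V"
    "card (slotted n d U V) * 2 ^ (2 * d + 1) \<le> card (slotted n d (U - {u}) (V - {v}))"
proof -
  have mod_bounds: "0 \<le> k mod int n" "k mod int n < int n" for k using n by simp_all
  \<comment> \<open>A pair at minimal cyclic distance has no other slot on the arc that is shifted.\<close>
  define dis where "dis p = (snd p - fst p) mod int n" for p :: "int \<times> int"
  have "finite (U \<times> V)" using U V finite_subset by blast
  moreover have "U \<times> V \<noteq> {}" using U(2) V(2) by blast
  ultimately obtain p where p: "p \<in> U \<times> V" "\<And>p'. p' \<in> U \<times> V \<Longrightarrow> dis p \<le> dis p'"
    using arg_min_if_finite[of "U \<times> V" dis] by (meson linorder_not_less)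
  obtain u v where uv: "p = (u, v)" "u \<in> U" "v \<in> V" using p(1) by blast
  define e where "e = (v - u) mod int n"
  have e_min: "e \<le> (v' - u') mod int n" if "u' \<in> U" "v' \<in> V" for u' v'
    using p(2)[of "(u', v')"] that by (simp add: dis_def uv e_def)
  have ints: "0 \<le> w" "w < int n" if "w \<in> U \<union> V" for w using that U V by auto
  have same: "w = w'" if "w \<in> U \<union> V" "w' \<in> U \<union> V" "(w - u) mod int n = (w' - u) mod int n" for w w'
  proof -
    have "((w - u) mod int n + u) mod int n = ((w' - u) mod int n + u) mod int n"
      using that(3) by simp
    then have "w mod int n = w' mod int n" by (simp add: mod_add_left_eq)
    then show ?thesis using ints[OF that(1)] ints[OF that(2)] by simp
  qed
  have "e \<noteq> 0" using same[of u v] uv UV(1) by (auto simp: e_def)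
  moreover have "0 \<le> e" "e < int n" unfolding e_def by (rule mod_bounds)+
  ultimately have e: "0 < e" "e < int n" by simp_all
  obtain c where c: "u + e = v + c * int n"
    unfolding e_def by (rule mod_representative[OF n(1)])
  have apart1: "apart d u (u + e)"
    using UV(2) uv c e unfolding spread_def by (metis UnI1 UnI2 less_add_same_cancel1)
  have "apart d v (u + (1 - c) * int n)"
  proof -
    have "v < u + (1 - c) * int n" using c e by (simp add: algebra_simps)
    then show ?thesis using UV(2) uv unfolding spread_def by blast
  qed
  then have apart2: "apart d (u + e) (u + int n)"
    by (rule apart_cong) (use c in \<open>simp add: algebra_simps\<close>)
  have rew: "rewriting n d u e x" if "x \<in> slotted n d U V" for x
  proof
    show "x \<in> step_words n d" "slot d x 1 u" using that uv by (auto simp: slotted_def)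
    have "slot d x (-1) (v + c * int n)"
      using that uv by (intro slot_periodic) (auto simp: slotted_def step_words_def)
    then show "slot d x (-1) (u + e)" by (simp add: c)
  qed (use n apart1 apart2 in auto)
  have keep: "slot d (rewrite_word n d u e x b) s w"
    if x: "x \<in> slotted n d U V" and w: "w \<in> (U - {u}) \<union> (V - {v})" and s: "slot d x s w" for x b s w
  proof -
    interpret rewriting n d u e x b by (rule rew[OF x])
    define q where "q = (w - u) mod int n"
    obtain c' where c': "u + q = w + c' * int n"
      unfolding q_def by (rule mod_representative[OF n(1)])
    have wUV: "w \<in> U \<union> V" using w by auto
    have q0: "0 \<le> q" "q < int n" unfolding q_def by (rule mod_bounds)+
    have "q \<noteq> e" using same[of w v] wUV uv w UV(1) by (auto simp: q_def e_def)
    \<comment> \<open>A further down slot at offset \<open>q < e\<close> would follow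
      \<open>u\<close> at distance \<open>q\<close>, and a further up slot there would precede
      \<open>v\<close> at distance \<open>e - q\<close>. Both contradict the minimality of
      \<open>e\<close> over all pairs.\<close>
    moreover have "\<not> q < e"
    proof
      assume less: "q < e"
      show False
      proof (cases "w \<in> V")
        case True
        then show ?thesis using e_min[of u w] uv less by (simp add: q_def)
      next
        case False
        then have wU: "w \<in> U" "w \<noteq> u" using w by auto
        then have "q \<noteq> 0" using same[of w u] uv by (auto simp: q_def)
        then have q: "0 < q" using q0 by simp
        have "(v - w) mod int n = (e - q) mod int n"
          by (simp add: e_def q_def mod_diff_eq)
        also have "\<dots> = e - q" using q less e by simp
        finally show ?thesis using e_min[OF wU(1) uv(3)] q by simp
      qed
    qed
    ultimately have q: "e < q" "q < int n" using q0 by simp_all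
    have "apart d v (w + (c' - c) * int n)"
    proof -
      have "v < w + (c' - c) * int n" using c c' q by (simp add: algebra_simps)
      then show ?thesis using UV(2) uv wUV unfolding spread_def by blast
    qed
    then have a1: "apart d (u + e) (u + q)"
      by (rule apart_cong) (use c c' in \<open>simp add: algebra_simps\<close>)
    have "apart d w (u + (1 - c') * int n)"
    proof -
      have "w < u + (1 - c') * int n" using c' q by (simp add: algebra_simps)
      then show ?thesis using UV(2) uv wUV unfolding spread_def by blast
    qed
    then have a2: "apart d (u + q) (u + int n)"
      by (rule apart_cong) (use c' in \<open>simp add: algebra_simps\<close>)
    have "slot d x s (u + q)" unfolding c' using x_per s by (intro slot_periodic) auto
    then have "slot d g s (u + q + (- c') * int n)"
      using g_periodic by (intro slot_periodic g_slot[OF _ a1 a2]) auto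
    then show ?thesis by (simp add: c')
  qed
  let ?B = "Pow {0..<2 * int d + 1}"
  let ?\<phi> = "\<lambda>(x, b). rewrite_word n d u e x b"
  have inj: "inj_on ?\<phi> (slotted n d U V \<times> ?B)"
  proof (rule inj_onI, clarify)
    fix x b x' b'
    assume a: "x \<in> slotted n d U V" "x' \<in> slotted n d U V" "b \<subseteq> {0..<2 * int d + 1}"
      "b' \<subseteq> {0..<2 * int d + 1}" "rewrite_word n d u e x b = rewrite_word n d u e x' b'"
    have "x = x'" by (rule rewriting_word_unique[OF rew[OF a(1)] rew[OF a(2)] a(5)])
    moreover have "b = b'"
      using rewriting.bits_from_g[OF rew[OF a(1)] a(3)] rewriting.bits_from_g[OF rew[OF a(2)] a(4)]
      unfolding a(5) by (rule trans_sym)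
    ultimately show "x = x' \<and> b = b'" ..
  qed
  have "?\<phi> ` (slotted n d U V \<times> ?B) \<subseteq> slotted n d (U - {u}) (V - {v})"
  proof (clarify)
    fix x b assume x: "x \<in> slotted n d U V"
    show "rewrite_word n d u e x b \<in> slotted n d (U - {u}) (V - {v})"
      using keep[OF x] x rewriting.g_step_word[OF rew[OF x]] unfolding slotted_def by blast
  qed
  then have "card (slotted n d U V \<times> ?B) \<le> card (slotted n d (U - {u}) (V - {v}))"
    by (intro card_inj_on_le[OF inj]) (auto simp: slotted_def finite_step_words[OF n(1)])
  then have "card (slotted n d U V) * 2 ^ (2 * d + 1) \<le> card (slotted n d (U - {u}) (V - {v}))"
    by (simp add: card_cartesian_product card_Pow nat_add_distrib nat_mult_distrib)
  then show ?thesis using that uv by blast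
qed

text \<open>Pairs are removed one at a time; subsets inherit \<open>spread\<close>, and with no
  slots left all step words are counted.\<close>

lemma card_slotted_le:
  assumes n: "n > 0" "even n" and "U \<subseteq> {0..<int n}" "V \<subseteq> {0..<int n}" "card U = r" "card V = r"
    and "U \<inter> V = {}" "spread n d (U \<union> V)"
  shows "card (slotted n d U V) * 2 ^ ((2 * d + 1) * r) \<le> card (step_words n d)"
  using assms(3-)
proof (induction r arbitrary: U V)
  case 0
  then have "U = {}" "V = {}" using finite_subset[OF _ finite_atLeastLessThan_int] by auto
  then show ?case by (simp add: slotted_def)
next
  case (Suc r)
  then have "U \<noteq> {}" "V \<noteq> {}" by auto
  then obtain u v where uv: "u \<in> U" "v \<in> V"
    "card (slotted n d U V) * 2 ^ (2 * d + 1) \<le> card (slotted n d (U - {u}) (V - {v}))"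
    using slotted_remove_pair[OF n] Suc.prems by metis
  have "spread n d ((U - {u}) \<union> (V - {v}))" using Suc.prems(6) unfolding spread_def by blast
  then have "card (slotted n d (U - {u}) (V - {v})) * 2 ^ ((2 * d + 1) * r) \<le> card (step_words n d)"
    using Suc.prems uv by (intro Suc.IH) auto
  moreover have "card (slotted n d U V) * 2 ^ (2 * d + 1) * 2 ^ ((2 * d + 1) * r)
      \<le> card (slotted n d (U - {u}) (V - {v})) * 2 ^ ((2 * d + 1) * r)"
    using uv(3) by (rule mult_right_mono) simp
  ultimately have "card (slotted n d U V) * 2 ^ (2 * d + 1) * 2 ^ ((2 * d + 1) * r)
      \<le> card (step_words n d)" by (rule order_trans[rotated])
  then show ?case by (simp add: power_add algebra_simps)
qed

section \<open>Turns of wide words\<close>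

lemma step_word_marks:
  assumes "x \<in> step_words n d" "mark x k" "mark x k'" "\<bar>k' - k\<bar> < 2 * int d"
  shows "even (k' - k)"
proof -
  have "even (b - a)" if "mark x a" "mark x b" "a < b" "b < a + 2 * int d" for a b
    using assms(1) that unfolding step_words_def by blast
  from this[of k k'] this[of k' k] show ?thesis
    using assms(2-4) by (cases k k' rule: linorder_cases) auto
qed

lemma turn_mark: "turn x s p \<Longrightarrow> mark x p"
  by (simp add: turn_def mark_def)

text \<open>The next mark \<open>p'\<close> has the other parity, so it is more than
  \<open>2 * d\<close> away. Marks shortly before \<open>p\<close> have the parity of
  \<open>p\<close>; those in the last window lie at or after \<open>p'\<close>, less than
  \<open>2 * d\<close> from it, and have the parity of \<open>p'\<close>.\<close>

lemma turn_slot: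
  assumes x: "x \<in> step_words n d" and "turn x s p"
  shows "slot d x s p"
proof -
  note m = turn_mark[OF assms(2)]
  obtain p' where p': "p' > p" "odd (p' - p)" "mark x p'"
    "\<And>k. p < k \<Longrightarrow> k < p' \<Longrightarrow> \<not> mark x k" and s: "x (p + 1) = s"
    using assms(2) unfolding turn_def by blast
  have far: "2 * int d < p' - p"
  proof -
    \<comment> \<open>The parity rule gives only a weak inequality; it is strict because the
      distance is odd.\<close>
    have "2 * int d \<le> p' - p" using step_word_marks[OF x m p'(3)] p'(1,2) by linarith
    then show ?thesis using p'(2) by (metis dvd_triv_left order_le_less)
  qed
  show ?thesis
    unfolding slot_def
  proof (intro conjI allI impI)
    fix k assume "p < k \<and> k \<le> p + 2 * int d"
    then show "\<not> mark x k" using p'(4)[of k] far by linarith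
  next
    fix k assume "p - 2 * int d < k \<and> k \<le> p \<and> mark x k"
    then show "even (k - p)" using step_word_marks[OF x m, of k] by simp
  next
    fix k assume k: "p + 2 * int d < k \<and> k \<le> p + 4 * int d \<and> mark x k"
    then have "p' \<le> k" using p'(4)[of k] by linarith
    then have "even (k - p')" using step_word_marks[OF x p'(3), of k] k far by linarith
    then show "odd (k - p)" using p'(2) by presburger
  qed (rule s)
qed

text \<open>Stated for an arbitrary later mark, which covers turns in either direction and all their
  translates by multiples of the period.\<close>

lemma turn_apart:
  assumes x: "x \<in> step_words n d" and "turn x s p" "mark x q" "p < q"
  shows "apart d p q"
proof -
  note m = turn_mark[OF assms(2)]
  obtain p' where p': "p' > p" "odd (p' - p)" "mark x p'"
    "\<And>k. p < k \<Longrightarrow> k < p' \<Longrightarrow> \<not> mark x k"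
    using assms(2) unfolding turn_def by blast
  have far: "2 * int d < b - a" if "mark x a" "mark x b" "a < b" "odd (b - a)" for a b
  proof -
    have "2 * int d \<le> b - a" using step_word_marks[OF x that(1,2)] that(3,4) by linarith
    then show ?thesis using that(4) by (metis dvd_triv_left order_le_less)
  qed
  have p'q: "p' \<le> q" using p'(4)[of q] assms(3,4) by linarith
  have 1: "2 * int d < p' - p" using far m p' by blast
  show ?thesis
  proof (cases "odd (q - p)")
    case True
    then show ?thesis using 1 p'q by (simp add: apart_def)
  next
    case False
    then have "odd (q - p')" using p'(2) by presburger
    moreover from this have "p' < q" using p'q by (cases "p' = q") auto
    ultimately have "2 * int d < q - p'" using far p'(3) assms(3) by blast
    then show ?thesis using 1 by (simp add: apart_def)
  qed
qed

lemma turns_spread: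
  assumes x: "x \<in> step_words n d" and "\<And>p. p \<in> S \<Longrightarrow> \<exists>s. turn x s p"
  shows "spread n d S"
  unfolding spread_def
proof (intro ballI allI impI)
  fix q q' c assume q: "q \<in> S" "q' \<in> S" "q < q' + c * int n"
  have "\<forall>k. x (k + int n) = x k" using x by (simp add: step_words_def)
  moreover have "mark x q'" using assms(2) q turn_mark by blast
  ultimately have "mark x (q' + c * int n)" by (simp add: mark_periodic)
  then show "apart d q (q' + c * int n)" using turn_apart[OF x] assms(2) q by blast
qed

lemma turn_periodic:
  assumes "\<forall>k. x (k + int n) = x k" "turn x s p"
  shows "turn x s (p + c * int n)"
proof -
  let ?t = "c * int n"
  obtain p' where p': "p' > p" "odd (p' - p)" "mark x p'"
    "\<And>k. p < k \<Longrightarrow> k < p' \<Longrightarrow> \<not> mark x k"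
    using assms(2) unfolding turn_def by blast
  have "x (p + ?t) = s" "x (p + ?t + 1) = s"
    using assms(2) periodic_mult[OF assms(1), of p c] periodic_mult[OF assms(1), of "p + 1" c]
    by (simp_all add: turn_def algebra_simps)
  moreover have "p' + ?t > p + ?t" "odd (p' + ?t - (p + ?t))" "mark x (p' + ?t)"
    using p' mark_periodic[OF assms(1)] by auto
  moreover have "\<not> mark x k" if "p + ?t < k" "k < p' + ?t" for k
    using p'(4)[of "k - ?t"] mark_periodic[OF assms(1), of "k - ?t" c] that by auto
  ultimately show ?thesis unfolding turn_def by blast
qed

section \<open>Turns forced by a large range of heights\<close>

lemma height_parity:
  fixes F :: "int \<Rightarrow> int"
  assumes "\<And>k. \<bar>F (k + 1) - F k\<bar> = 1" "a \<le> k"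
  shows "even (F k - F a - (k - a))"
  using assms(2)
proof (induction k rule: int_ge_induct)
  case (step i)
  have "odd (F (i + 1) - F i)" using assms(1)[of i] by presburger
  then show ?case using step by presburger
qed simp

text \<open>Let \<open>j\<close> be the first time at height \<open>l + 3\<close> and
  \<open>i\<close> the last time before it at height \<open>l\<close>. In between the heights are
  \<open>l + 1\<close> and \<open>l + 2\<close>, and two equal steps there would change the height
  by \<open>2\<close>, so there is no mark. The path leaves \<open>l\<close> and reaches
  \<open>l + 3\<close> by two up-steps each, which gives marks at \<open>i\<close> and
  \<open>j - 2\<close>; their distance is odd because \<open>j - i\<close> has the parity of
  \<open>3\<close>.\<close>

lemma turn_exists:
  fixes F :: "int \<Rightarrow> int"
  assumes st: "\<And>k. \<bar>F (k + 1) - F k\<bar> = 1" and "a \<le> b" "F a \<le> l" "l + 3 \<le> F b"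
  shows "\<exists>p. F p = l \<and> turn (\<lambda>k. F (k + 1) - F k) 1 p"
proof -
  let ?J = "{k \<in> {a..b}. l + 3 \<le> F k}"
  have J: "finite ?J" "?J \<noteq> {}" using assms(2,4) by (auto intro: finite_subset[of _ "{a..b}"])
  define j where "j = Min ?J"
  have j: "a \<le> j" "l + 3 \<le> F j" using Min_in[OF J] by (auto simp: j_def)
  have before: "F k < l + 3" if "a \<le> k" "k < j" for k
  proof (rule ccontr)
    assume "\<not> F k < l + 3"
    then have "k \<in> ?J" using that Min_in[OF J] by (auto simp: j_def)
    then have "j \<le> k" using Min_le[OF J(1)] by (simp only: j_def)
    then show False using that by simp
  qed
  let ?I = "{k \<in> {a..j}. F k \<le> l}"
  have I: "finite ?I" "?I \<noteq> {}" using assms(3) j by (auto intro: finite_subset[of _ "{a..j}"])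
  define i where "i = Max ?I"
  have i: "a \<le> i" "i \<le> j" "F i \<le> l" using Max_in[OF I] by (auto simp: i_def)
  have after: "l < F k" if "i < k" "k \<le> j" for k
  proof (rule ccontr)
    assume "\<not> l < F k"
    then have "k \<in> ?I" using that i by auto
    then have "k \<le> i" using Max_ge[OF I(1)] by (simp only: i_def)
    then show False using that by simp
  qed
  have par: "even (F k - F i - (k - i))" if "i \<le> k" for k
    by (rule height_parity[where F = F]) (use st that in auto)
  have ij: "i < j" using i j by (cases "i = j") auto
  have Fi: "F i = l" using st[of i] after[of "i + 1"] i ij by linarith
  have Fj: "F j = l + 3" using st[of "j - 1"] before[of "j - 1"] i j ij by auto
  have Fi1: "F (i + 1) = l + 1" using st[of i] after[of "i + 1"] Fi ij by linarith
  have "j \<noteq> i + 1" "j \<noteq> i + 2" using Fi1 Fj st[of "i + 1"] by (auto simp: add.assoc)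
  then have ij2: "i + 2 < j" using ij by linarith
  have Fi2: "F (i + 2) = l + 2" using st[of "i + 1"] after[of "i + 2"] Fi1 ij2 by (auto simp: add.assoc)
  have Fj1: "F (j - 1) = l + 2" using st[of "j - 1"] before[of "j - 1"] Fj ij i by auto
  have "odd (j - 2 - i)" using par[of j] ij Fi Fj by simp
  moreover from this have "i < j - 2" using ij2 by presburger
  moreover have "mark (\<lambda>k. F (k + 1) - F k) (j - 2)"
  proof -
    have "F (j - 2) < l + 3" using before[of "j - 2"] i ij2 by linarith
    then have "F (j - 2) = l + 1" using st[of "j - 2"] Fj1 by auto
    then show ?thesis using Fj1 Fj by (simp add: mark_def)
  qed
  moreover have "\<not> mark (\<lambda>k. F (k + 1) - F k) k" if "i < k" "k < j - 2" for k
  proof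
    assume "mark (\<lambda>k. F (k + 1) - F k) k"
    then have "F (k + 2) - F k = 2 * (F (k + 1) - F k)" by (simp add: mark_def add.assoc)
    moreover have "l < F k" "l < F (k + 2)" "F k < l + 3" "F (k + 2) < l + 3"
      using after[of k] after[of "k + 2"] before[of k] before[of "k + 2"] that i by auto
    moreover have "F (k + 1) - F k = 1 \<or> F (k + 1) - F k = - 1" using st[of k] by arith
    ultimately show False by auto
  qed
  ultimately have "turn (\<lambda>k. F (k + 1) - F k) 1 i"
    unfolding turn_def using Fi Fi1 Fi2 by (auto simp: add.assoc)
  then show ?thesis using Fi by blast
qed

text \<open>One turn starts at each of the \<open>r\<close> heights \<open>F a\<close>, ...,
  \<open>F a + r - 1\<close>. Different heights keep the turns distinct after reduction modulo
  \<open>n\<close>.\<close>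

lemma many_turns:
  fixes F :: "int \<Rightarrow> int"
  assumes st: "\<And>k. \<bar>F (k + 1) - F k\<bar> = 1" and n: "n > 0" and per: "\<forall>k. F (k + int n) = F k"
    and ab: "F a + 2 + int r \<le> F b"
  shows "r \<le> card {p \<in> {0..<int n}. turn (\<lambda>k. F (k + 1) - F k) 1 p}"
proof -
  let ?x = "\<lambda>k. F (k + 1) - F k"
  have xper: "\<forall>k. ?x (k + int n) = ?x k"
    using per by (metis add.assoc add.commute)
  \<comment> \<open>A translate of \<open>b\<close> by a multiple of the period that is not to the
    left of \<open>a\<close>.\<close>
  define b' where "b' = b + \<bar>b - a\<bar> * int n"
  have "\<bar>b - a\<bar> * 1 \<le> \<bar>b - a\<bar> * int n" using n by (intro mult_left_mono) auto
  then have ab': "a \<le> b'" "F b' = F b" using periodic_mult[OF per] by (auto simp: b'_def)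
  have "\<exists>p. F p = F a + int t \<and> turn ?x 1 p \<and> p \<in> {0..<int n}" if "t < r" for t
  proof -
    have "\<exists>p. F p = F a + int t \<and> turn ?x 1 p"
      using ab ab' that by (intro turn_exists[where F = F and a = a and b = b']) (use st in auto)
    then obtain p where p: "F p = F a + int t" "turn ?x 1 p" by blast
    have eq: "p mod int n = p + (- (p div int n)) * int n"
      by (simp add: minus_div_mult_eq_mod[symmetric])
    have "F (p mod int n) = F a + int t" unfolding eq using p(1) periodic_mult[OF per] by metis
    moreover have "turn ?x 1 (p mod int n)" unfolding eq by (rule turn_periodic[OF xper p(2)])
    ultimately show ?thesis using n by (intro exI[of _ "p mod int n"]) simp
  qed
  then obtain P where P: "\<And>t. t < r \<Longrightarrow> F (P t) = F a + int t \<and> turn ?x 1 (P t) \<and> P t \<in> {0..<int n}"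
    by metis
  have "inj_on P {..<r}"
    by (rule inj_onI) (metis P lessThan_iff add_left_cancel of_nat_eq_iff)
  then have "r = card (P ` {..<r})" by (simp add: card_image)
  also have "\<dots> \<le> card {p \<in> {0..<int n}. turn ?x 1 p}"
    using P by (intro card_mono) (auto intro: finite_subset[of _ "{0..<int n}"])
  finally show ?thesis .
qed

lemma turn_uminus: "turn (\<lambda>k. - x k) (- s) p = turn x s p"
  by (simp add: turn_def mark_def)

section \<open>Words of torus homomorphisms\<close>

definition height :: "nat \<Rightarrow> (nat \<Rightarrow> int) \<Rightarrow> int \<Rightarrow> int" where
  "height n f k = f (nat (k mod int n))"

definition word :: "nat \<Rightarrow> (nat \<Rightarrow> int) \<Rightarrow> int \<Rightarrow> int" where
  "word n f k = height n f (k + 1) - height n f k"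

lemma height_periodic: "height n f (k + int n) = height n f k"
  by (simp add: height_def)

lemma height_nat: "i < n \<Longrightarrow> height n f (int i) = f i"
  by (simp add: height_def)

lemma odd_pos_int:
  fixes j :: int
  assumes "odd j" "0 < j"
  obtains m where "j = 2 * int m + 1"
proof
  show "j = 2 * int (nat (j div 2)) + 1" using assms by simp
qed

text \<open>The step \<open>j\<close> may exceed \<open>n\<close>. Since \<open>n\<close> is even,
  its residue \<open>r\<close> is still odd, and so is the cyclic distance
  \<open>min r (n - r)\<close>, which is positive and at most \<open>j\<close>.\<close>

lemma torus_adj_shift:
  assumes n: "n > 0" "even n" and j: "odd j" "0 < j" "j \<le> 2 * int d + 1"
  shows "torus_adj n d (nat ((k + j) mod int n)) (nat (k mod int n))"
proof -
  define a r where "a = k mod int n" and "r = j mod int n"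
  have a: "0 \<le> a" "a < int n" using n by (auto simp: a_def)
  have "odd r" using j(1) n(2) unfolding r_def by (metis dvd_mod_iff even_of_nat)
  moreover have "0 \<le> r" "r < int n" using n by (auto simp: r_def)
  moreover have "r \<le> j" using j n by (simp add: r_def zmod_le_nonneg_dividend)
  ultimately have r: "odd r" "0 < r" "r < int n" "r \<le> j" by (auto simp: order.strict_iff_order)
  have "(k + j) mod int n = (a + r) mod int n" by (simp add: a_def r_def mod_add_eq)
  also have "\<dots> = (if a + r < int n then a + r else a + r - int n)"
  proof (cases "a + r < int n")
    case False
    then show ?thesis
      using a r minus_mod_self2[of "a + r" "int n"] mod_pos_pos_trivial[of "a + r - int n" "int n"] by simp
  qed (use a r in simp)
  finally have b: "(k + j) mod int n = (if a + r < int n then a + r else a + r - int n)" .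
  define m where "m = min r (int n - r)"
  have m: "odd m" "0 < m" "m \<le> 2 * int d + 1" using r j n(2) by (auto simp: m_def min_def)
  obtain i where i: "m = 2 * int i + 1" using m(1,2) by (rule odd_pos_int)
  then have "i \<le> d" using m by simp
  have "min \<bar>(k + j) mod int n - a\<bar> (int n - \<bar>(k + j) mod int n - a\<bar>) = m"
    using r a by (auto simp: b m_def min_def)
  then show ?thesis
    using a n i \<open>i \<le> d\<close> by (auto simp: torus_adj_def torus_vertices_def a_def nat_less_iff)
qed

lemma torus_adj_obtain_shift:
  assumes n: "n > 0" "even n" and "torus_adj n d i j"
  obtains m where "odd m" "0 < m" "m \<le> 2 * int d + 1"
    "j = nat ((int i + m) mod int n) \<or> i = nat ((int j + m) mod int n)"
proof -
  have ij: "i < n" "j < n" using assms(3) by (auto simp: torus_adj_def torus_vertices_def)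
  obtain k where k: "min \<bar>int i - int j\<bar> (int n - \<bar>int i - int j\<bar>) = 2 * int k + 1" "k \<le> d"
    using assms(3) by (auto simp: torus_adj_def)
  define m where "m = 2 * int k + 1"
  have m: "odd m" "0 < m" "m \<le> 2 * int d + 1" using k by (auto simp: m_def)
  \<comment> \<open>The cases tell which endpoint comes first and whether the step wraps
    around.\<close>
  consider "int j = int i + m" | "int i = int j + m" | "int i + m = int j + int n"
    | "int j + m = int i + int n"
    using k(1) unfolding m_def[symmetric] by (auto simp: min_def abs_if split: if_splits)
  then have "j = nat ((int i + m) mod int n) \<or> i = nat ((int j + m) mod int n)"
  proof cases
    case 1
    then show ?thesis using ij by (metis mod_less nat_int zmod_int)
  next
    case 2
    then show ?thesis using ij by (metis mod_less nat_int zmod_int)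
  next
    case 3
    then show ?thesis using ij by simp
  next
    case 4
    then show ?thesis using ij by simp
  qed
  then show thesis using that m by blast
qed

lemma height_step:
  assumes n: "n > 0" "even n" and "f \<in> torus_homs n d" and j: "odd j" "0 < j" "j \<le> 2 * int d + 1"
  shows "\<bar>height n f (k + j) - height n f k\<bar> = 1"
  using assms(3) torus_adj_shift[OF n j, of k] unfolding torus_homs_def height_def by blast

lemma word_in_step_words:
  assumes n: "n > 0" "even n" and f: "f \<in> torus_homs n d"
  shows "word n f \<in> step_words n d"
proof -
  let ?F = "height n f"
  note st = height_step[OF n f]
  have near: "\<bar>?F k - ?F k'\<bar> = 1" if "odd (k' - k)" "\<bar>k' - k\<bar> \<le> 2 * int d + 1" for k k'
  proof (cases "k < k'")
    case True
    then show ?thesis using st[of "k' - k" k] that by (simp add: abs_minus_commute)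
  next
    case False
    moreover have "k \<noteq> k'" using that by auto
    ultimately show ?thesis using st[of "k - k'" k'] that by simp
  qed
  have one: "\<bar>?F (k + 1) - ?F k\<bar> = 1" for k using near[of "k + 1" k] by simp
  have "(\<Sum>k\<in>{0..<int m}. word n f k) = ?F (int m) - ?F 0" for m
  proof (induction m)
    case (Suc m)
    have "{0..<int (Suc m)} = insert (int m) {0..<int m}" by auto
    then show ?case using Suc by (simp add: word_def add.commute)
  qed simp
  then have "(\<Sum>k\<in>{0..<int n}. word n f k) = 0" using height_periodic[of n f 0] by simp
  moreover have "word n f k = 1 \<or> word n f k = - 1" for k using one[of k] by (auto simp: word_def)
  moreover have "word n f (k + int n) = word n f k" for k
    using height_periodic[of n f k] height_periodic[of n f "k + 1"] by (simp add: word_def algebra_simps)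
  moreover have "even (k' - k)"
    if "mark (word n f) k" "mark (word n f) k'" "k < k'" "k' < k + 2 * int d" for k k'
  proof (rule ccontr)
    assume odd: "odd (k' - k)"
    have d2: "\<bar>?F (a + 2) - ?F a\<bar> = 2" if "mark (word n f) a" for a
      using that one[of a] one[of "a + 1"] by (auto simp: mark_def word_def add.assoc)
    \<comment> \<open>All four distances are odd and at most \<open>2 * d + 1\<close>. The heights
      at \<open>k\<close> and \<open>k + 2\<close> differ by \<open>2\<close>, so \<open>k'\<close>
      and \<open>k' + 2\<close> both have the height midway between them, although \<open>k'\<close>
      is a mark.\<close>
    have "\<bar>?F k - ?F k'\<bar> = 1" "\<bar>?F (k + 2) - ?F k'\<bar> = 1" "\<bar>?F k - ?F (k' + 2)\<bar> = 1"
      "\<bar>?F (k + 2) - ?F (k' + 2)\<bar> = 1"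
      using odd that by (auto intro!: near)
    then show False using d2[OF that(1)] d2[OF that(2)] by linarith
  qed
  ultimately show ?thesis unfolding step_words_def by blast
qed

lemma inj_on_word: "inj_on (word n) (torus_homs n d)"
proof (rule inj_onI)
  fix f g assume f: "f \<in> torus_homs n d" and g: "g \<in> torus_homs n d" and eq: "word n f = word n g"
  have "height n f (int i) = height n g (int i)" for i
  proof (induction i)
    case 0
    then show ?case using f g by (simp add: height_def torus_homs_def)
  next
    case (Suc i)
    have "word n f (int i) = word n g (int i)" using eq by simp
    then show ?case using Suc by (simp add: word_def add.commute)
  qed
  then have "f i = g i" if "i < n" for i using height_nat that by metis
  then show "f = g" using f g unfolding torus_homs_def torus_vertices_def
    by (auto intro: PiE_ext[of f "{0..<n}" _ g])
qed

text \<open>Take partial sums. For an edge of length \<open>2 * m + 1\<close> starting at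
  \<open>k\<close>, the parity rule excludes marks either from all of \<open>k\<close>,
  \<open>k + 2\<close>, ..., \<open>k + 2 * m - 2\<close> or from all of \<open>k + 1\<close>,
  \<open>k + 3\<close>, ..., \<open>k + 2 * m - 1\<close>. Without marks the height is constant
  along steps of length two, so the heights at the ends of the edge differ by a single
  letter.\<close>

lemma word_surj:
  assumes n: "n > 0" "even n" and x: "x \<in> step_words n d"
  shows "x \<in> word n ` torus_homs n d"
proof -
  define f where "f = (\<lambda>i\<in>torus_vertices n. \<Sum>k\<in>{0..<int i}. x k)"
  let ?F = "height n f"
  have per: "\<forall>k. x (k + int n) = x k" and s0: "(\<Sum>k\<in>{0..<int n}. x k) = 0"
    and "\<forall>k. x k = 1 \<or> x k = - 1"
    using x by (auto simp: step_words_def)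
  then have xc: "\<bar>x k\<bar> = 1" for k by (metis abs_minus_cancel abs_one)
  have Suc_sum: "(\<Sum>k\<in>{0..<int i + 1}. x k) = (\<Sum>k\<in>{0..<int i}. x k) + x (int i)" for i
  proof -
    have "{0..<int i + 1} = insert (int i) {0..<int i}" by auto
    then show ?thesis by simp
  qed
  have wf: "word n f k = x k" for k
  proof -
    define i where "i = nat (k mod int n)"
    have i: "i < n" "int i = k mod int n" using n by (auto simp: i_def nat_less_iff)
    have Fk: "?F k = (\<Sum>k\<in>{0..<int i}. x k)"
      using i by (simp add: height_def f_def torus_vertices_def i_def)
    have "(k + 1) mod int n = (int i + 1) mod int n" by (simp add: i mod_add_left_eq)
    then have "?F (k + 1) = (\<Sum>k\<in>{0..<int i + 1}. x k)"
    proof (cases "i + 1 = n")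
      case True
      then have "int i + 1 = int n" by linarith
      moreover from this have "(k + 1) mod int n = 0"
        using \<open>(k + 1) mod int n = (int i + 1) mod int n\<close> by simp
      \<comment> \<open>At the end of the period the height returns to \<open>0\<close>, which is
        the sum over a full period.\<close>
      ultimately show ?thesis using s0 n by (simp add: height_def f_def torus_vertices_def)
    next
      case False
      then have "(k + 1) mod int n = int (i + 1)"
        using \<open>(k + 1) mod int n = (int i + 1) mod int n\<close> i by simp
      then show ?thesis using False i
        by (simp add: height_def f_def torus_vertices_def nat_add_distrib add.commute)
    qed
    then have "word n f k = x (int i)" using Fk Suc_sum by (simp add: word_def)
    also have "int i = k + (- (k div int n)) * int n" by (simp add: i minus_div_mult_eq_mod[symmetric])
    also have "x \<dots> = x k" by (rule periodic_mult[OF per])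
    finally show ?thesis .
  qed
  have d1: "?F (k + 1) = ?F k + x k" for k using wf[of k] by (simp add: word_def)
  have d2: "?F (k + 2) = ?F k" if "\<not> mark x k" for k
    using d1[of k] d1[of "k + 1"] that xc[of k] xc[of "k + 1"]
    by (auto simp: mark_def add.assoc abs_if split: if_splits)
  have near: "\<bar>?F (k + j) - ?F k\<bar> = 1" if j: "odd j" "0 < j" "j \<le> 2 * int d + 1" for k j
  proof -
    obtain m where m: "j = 2 * int m + 1" using j(1,2) by (rule odd_pos_int)
    have const: "?F (a + 2 * int i) = ?F a" if "\<And>l. l < i \<Longrightarrow> \<not> mark x (a + 2 * int l)" for a i
      using that
    proof (induction i)
      case (Suc i)
      then show ?case using d2[of "a + 2 * int i"] by (simp add: algebra_simps)
    qed simp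
    show ?thesis
    proof (cases "\<exists>l<m. mark x (k + 1 + 2 * int l)")
      case False
      then have "?F (k + 1 + 2 * int m) = ?F (k + 1)" by (intro const) auto
      then show ?thesis using d1[of k] xc[of k] by (simp add: m algebra_simps)
    next
      case True
      then obtain l where l: "l < m" "mark x (k + 1 + 2 * int l)" by blast
      have "\<not> mark x (k + 2 * int i)" if "i < m" for i
      proof
        assume "mark x (k + 2 * int i)"
        then have "even (k + 2 * int i - (k + 1 + 2 * int l))"
          by (rule step_word_marks[OF x l(2)]) (use l(1) that j m in auto)
        then show False by simp
      qed
      then have "?F (k + 2 * int m) = ?F k" by (rule const)
      then show ?thesis using d1[of "k + 2 * int m"] xc[of "k + 2 * int m"] by (simp add: m algebra_simps)
    qed
  qed
  have "\<bar>f i - f j\<bar> = 1" if adj: "torus_adj n d i j" for i j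
  proof -
    have ij: "i < n" "j < n" using adj by (auto simp: torus_adj_def torus_vertices_def)
    obtain m where m: "odd m" "0 < m" "m \<le> 2 * int d + 1"
      "j = nat ((int i + m) mod int n) \<or> i = nat ((int j + m) mod int n)"
      using torus_adj_obtain_shift[OF n adj] by blast
    from m(4) have "?F (int i + m) = f j \<or> ?F (int j + m) = f i" by (auto simp: height_def)
    then show ?thesis
      using near[OF m(1-3), of "int i"] near[OF m(1-3), of "int j"] height_nat ij
      by (metis abs_minus_commute)
  qed
  then have "f \<in> torus_homs n d" using n by (simp add: torus_homs_def f_def torus_vertices_def)
  moreover have "x = word n f" using wf by auto
  ultimately show ?thesis by blast
qed

lemma card_step_words:
  assumes "n > 0" "even n"
  shows "card (step_words n d) = card (torus_homs n d)"
proof -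
  have "word n ` torus_homs n d = step_words n d"
    using word_in_step_words[OF assms] word_surj[OF assms] by blast
  then show ?thesis using card_image[OF inj_on_word] by metis
qed

lemma wide_hom_slotted:
  assumes n: "n > 0" "even n" and f: "f \<in> torus_homs n d" and wide: "3 + r \<le> card (Rng n f)"
  obtains U V where "U \<subseteq> {0..<int n}" "V \<subseteq> {0..<int n}" "card U = r" "card V = r" "U \<inter> V = {}"
    "spread n d (U \<union> V)" "word n f \<in> slotted n d U V"
proof -
  let ?F = "height n f"
  have R: "finite (Rng n f)" "Rng n f \<noteq> {}" using n by (auto simp: Rng_def torus_vertices_def)
  define m M where "m = Min (Rng n f)" and "M = Max (Rng n f)"
  have "m \<in> Rng n f" "M \<in> Rng n f" using R by (simp_all add: m_def M_def)
  then obtain a b where ab: "a < n" "b < n" "f a = m" "f b = M"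
    by (auto simp: Rng_def torus_vertices_def)
  have "Rng n f \<subseteq> {m..M}" using R by (auto simp: m_def M_def)
  then have "card (Rng n f) \<le> nat (M - m + 1)"
    by (metis card_atLeastAtMost_int card_mono finite_atLeastAtMost_int add.commute diff_add_eq)
  then have Mm: "m + 2 + int r \<le> M" using wide by linarith
  have st: "\<bar>?F (k + 1) - ?F k\<bar> = 1" for k by (rule height_step[OF n f]) auto
  have per: "\<forall>k. ?F (k + int n) = ?F k" by (simp add: height_periodic)
  let ?U = "{p \<in> {0..<int n}. turn (word n f) 1 p}"
  let ?V = "{p \<in> {0..<int n}. turn (word n f) (-1) p}"
  have "r \<le> card {p \<in> {0..<int n}. turn (\<lambda>k. ?F (k + 1) - ?F k) 1 p}"
    by (rule many_turns[where F = ?F and a = "int a" and b = "int b"])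
      (use st n per ab Mm height_nat in auto)
  then have "r \<le> card ?U" by (simp add: word_def[abs_def])
  then obtain U where U: "U \<subseteq> ?U" "card U = r" by (rule obtain_subset_with_card_n)
  \<comment> \<open>Down turns are the up turns of the negated height, which rises from the maximum
    at \<open>b\<close> to the minimum at \<open>a\<close>.\<close>
  have "r \<le> card {p \<in> {0..<int n}. turn (\<lambda>k. - ?F (k + 1) - - ?F k) 1 p}"
    by (rule many_turns[where F = "\<lambda>k. - ?F k" and a = "int b" and b = "int a"])
      (use st n per ab Mm height_nat in \<open>auto simp: abs_minus_commute\<close>)
  moreover have "turn (\<lambda>k. - ?F (k + 1) - - ?F k) 1 p = turn (word n f) (-1) p" for p
    using turn_uminus[of "word n f" "-1" p] by (simp add: word_def[abs_def])
  ultimately have "r \<le> card ?V" by simp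
  then obtain V where V: "V \<subseteq> ?V" "card V = r" by (rule obtain_subset_with_card_n)
  note w = word_in_step_words[OF n f]
  show ?thesis
  proof (rule that)
    show "U \<inter> V = {}" using U V unfolding turn_def by fastforce
    show "spread n d (U \<union> V)" by (rule turns_spread[OF w]) (use U V in auto)
    show "word n f \<in> slotted n d U V"
      unfolding slotted_def using w turn_slot[OF w] U(1) V(1) by blast
  qed (use U V in auto)
qed

section \<open>Probabilities\<close>

text \<open>A union bound over the positions \<open>(U, V)\<close> of the chosen turns. Only
  disjoint pairs with \<open>spread\<close> occur, which are those that
  \<open>card_slotted_le\<close> can estimate.\<close>

lemma card_wide_homs:
  assumes n: "n > 0" "even n"
  shows "card {f \<in> torus_homs n d. 3 + r \<le> card (Rng n f)} * 2 ^ ((2 * d + 1) * r)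
    \<le> (n choose r) ^ 2 * card (torus_homs n d)"
proof -
  let ?A = "{f \<in> torus_homs n d. 3 + r \<le> card (Rng n f)}"
  let ?K = "2 ^ ((2 * d + 1) * r) :: nat"
  let ?P = "{U. U \<subseteq> {0..<int n} \<and> card U = r}"
  let ?Q = "{(U, V) \<in> ?P \<times> ?P. U \<inter> V = {} \<and> spread n d (U \<union> V)}"
  have P: "finite ?P" "card ?P = n choose r"
    using n_subsets[of "{0..<int n}" r] by (auto intro: finite_subset[of _ "Pow {0..<int n}"])
  have Q: "finite ?Q" "card ?Q \<le> card (?P \<times> ?P)"
  proof -
    have sub: "?Q \<subseteq> ?P \<times> ?P" by blast
    show "finite ?Q" by (rule finite_subset[OF sub]) (use P(1) in blast)
    show "card ?Q \<le> card (?P \<times> ?P)" by (rule card_mono[OF _ sub]) (use P(1) in blast)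
  qed
  have fin: "finite (slotted n d U V)" for U V
    by (rule finite_subset[OF _ finite_step_words[OF n(1), of d]]) (auto simp: slotted_def)
  have "word n ` ?A \<subseteq> (\<Union>(U, V)\<in>?Q. slotted n d U V)"
  proof
    fix x assume "x \<in> word n ` ?A"
    then obtain f where f: "f \<in> torus_homs n d" "3 + r \<le> card (Rng n f)" "x = word n f" by blast
    show "x \<in> (\<Union>(U, V)\<in>?Q. slotted n d U V)"
      by (rule wide_hom_slotted[OF n f(1,2)]) (use f(3) in blast)
  qed
  moreover have "inj_on (word n) ?A" using inj_on_word by (rule inj_on_subset) auto
  ultimately have "card ?A \<le> card (\<Union>(U, V)\<in>?Q. slotted n d U V)"
    using Q(1) fin by (metis (no_types, lifting) card_image card_mono finite_UN case_prod_beta')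
  also have "\<dots> \<le> (\<Sum>p\<in>?Q. card (case p of (U, V) \<Rightarrow> slotted n d U V))"
    by (rule card_UN_le[OF Q(1)])
  finally have "card ?A * ?K \<le> (\<Sum>p\<in>?Q. card (case p of (U, V) \<Rightarrow> slotted n d U V)) * ?K"
    by simp
  also have "\<dots> = (\<Sum>p\<in>?Q. card (case p of (U, V) \<Rightarrow> slotted n d U V) * ?K)"
    by (simp add: sum_distrib_right)
  also have "\<dots> \<le> (\<Sum>p\<in>?Q. card (step_words n d))"
    by (intro sum_mono) (use card_slotted_le[OF n] in auto)
  also have "\<dots> \<le> (n choose r) ^ 2 * card (step_words n d)"
    using Q(2) P by (simp add: card_cartesian_product power2_eq_square)
  finally show ?thesis using card_step_words[OF n] by simp
qed

section \<open>Homomorphisms with fewer than three values\<close>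

text \<open>Edges join vertices of opposite parity, so the value \<open>0\<close> on even vertices
  allows a free choice of sign on each of the \<open>n div 2\<close> odd ones.\<close>

lemma card_torus_homs_ge:
  assumes "n > 0" "even n"
  shows "2 ^ (n div 2) \<le> card (torus_homs n d)"
proof -
  define h :: "nat set \<Rightarrow> nat \<Rightarrow> int" where
    "h T = (\<lambda>i\<in>torus_vertices n. if even i then 0 else if i div 2 \<in> T then 1 else -1)" for T
  have "h T \<in> torus_homs n d" for T
  proof -
    have "\<bar>h T i - h T j\<bar> = 1" if "torus_adj n d i j" for i j
    proof -
      have "i \<in> torus_vertices n" "j \<in> torus_vertices n"
        using that by (simp_all add: torus_adj_def)
      then show ?thesis
        using torus_adj_parity[OF assms(2) that] by (cases "even i") (simp_all add: h_def)
    qed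
    moreover have "h T 0 = 0" "h T \<in> torus_vertices n \<rightarrow>\<^sub>E UNIV"
      using assms(1) by (simp_all add: h_def torus_vertices_def)
    ultimately show ?thesis by (simp add: torus_homs_def)
  qed
  moreover have "inj_on h (Pow {..<n div 2})"
  proof (rule inj_onI)
    fix T T' assume T: "T \<in> Pow {..<n div 2}" "T' \<in> Pow {..<n div 2}" "h T = h T'"
    have "j \<in> T \<longleftrightarrow> j \<in> T'" if "j < n div 2" for j
    proof -
      have "2 * j + 1 < n" using that by linarith
      then show ?thesis
        using fun_cong[OF T(3), of "2 * j + 1"]
        by (simp add: h_def torus_vertices_def split: if_splits)
    qed
    then show "T = T'" using T(1,2) by blast
  qed
  ultimately have "card (Pow {..<n div 2}) \<le> card (torus_homs n d)"
    by (intro card_inj_on_le[of h]) (auto simp: finite_torus_homs)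
  then show ?thesis by (simp add: card_Pow)
qed

text \<open>The only values are \<open>0\<close> and \<open>f 1\<close>, and consecutive values
  differ, so \<open>f\<close> alternates and is determined by the sign of
  \<open>f 1\<close>.\<close>

lemma card_narrow_homs:
  assumes n: "n > 0" "even n"
  shows "card {f \<in> torus_homs n d. card (Rng n f) < 3} \<le> 2"
proof -
  let ?B = "{f \<in> torus_homs n d. card (Rng n f) < 3}"
  have n2: "1 < n" using n by (metis One_nat_def dvd_1_iff_1 nat_neq_iff less_one Suc_lessI even_Suc even_zero)
  have step: "\<bar>f i - f (Suc i)\<bar> = 1" if "f \<in> torus_homs n d" "Suc i < n" for f i
    using that torus_adj_Suc[of i n d] by (auto simp: torus_homs_def)
  have f1: "f 1 = 1 \<or> f 1 = - 1" if "f \<in> torus_homs n d" for f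
    using step[OF that, of 0] n2 that by (auto simp: torus_homs_def)
  have alt: "f i = (if even i then 0 else f 1)" if f: "f \<in> ?B" and "i < n" for f i
  proof -
    have f: "f \<in> torus_homs n d" "card (Rng n f) < 3" using f by auto
    have "{0, f 1} \<subseteq> Rng n f"
      using f(1) n n2 by (force simp: Rng_def torus_vertices_def torus_homs_def)
    moreover have "finite (Rng n f)" by (simp add: Rng_def torus_vertices_def)
    moreover have "card {0, f 1} = 2" using f1[OF f(1)] by auto
    ultimately have R: "Rng n f = {0, f 1}"
      using f(2) by (metis card_seteq less_Suc_eq_le numeral_3_eq_3 numeral_2_eq_2)
    show ?thesis using \<open>i < n\<close>
    proof (induction i)
      case 0
      then show ?case using f(1) by (simp add: torus_homs_def)
    next
      case (Suc i)
      have "f (Suc i) \<in> {0, f 1}" unfolding R[symmetric] Rng_def torus_vertices_def using Suc.prems by simp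
      then show ?case using Suc step[OF f(1) Suc.prems] by (auto split: if_splits)
    qed
  qed
  have "inj_on (\<lambda>f. f 1) ?B"
  proof (rule inj_onI)
    fix f g assume fg: "f \<in> ?B" "g \<in> ?B" "f 1 = g 1"
    then have "f i = g i" if "i \<in> torus_vertices n" for i
      using alt[of f i] alt[of g i] that by (simp add: torus_vertices_def)
    then show "f = g" using fg by (auto simp: torus_homs_def intro: PiE_ext)
  qed
  then have "card ?B \<le> card {1, - 1 :: int}"
    by (rule card_inj_on_le) (use f1 in auto)
  then show ?thesis by simp
qed

section \<open>From counts to probabilities and the limit\<close>

lemma prob_uniform_hom:
  assumes "n > 0" "even n"
  shows "measure_pmf.prob (uniform_hom n d) {f. P f} =
    real (card {f \<in> torus_homs n d. P f}) / real (card (torus_homs n d))"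
  unfolding uniform_hom_def
  by (subst measure_pmf_of_set[OF torus_homs_nonempty[OF assms] finite_torus_homs])
    (simp add: Int_def)

lemma card_torus_homs_pos:
  "n > 0 \<Longrightarrow> even n \<Longrightarrow> 0 < card (torus_homs n d)"
  using torus_homs_nonempty finite_torus_homs by (simp add: card_gt_0_iff)

lemma prob_wide:
  assumes n: "n > 0" "even n"
  shows "measure_pmf.prob (uniform_hom n d) {f. card (Rng n f) \<ge> 3 + r}
    \<le> real (n choose r) ^ 2 * 2 powr (- ((2 * real d - 1) * real r))"
proof -
  let ?a = "real (card {f \<in> torus_homs n d. 3 + r \<le> card (Rng n f)})"
  let ?h = "real (card (torus_homs n d))"
  have h: "0 < ?h" using card_torus_homs_pos[OF n] by simp
  have "?a * 2 ^ ((2 * d + 1) * r) \<le> real (n choose r) ^ 2 * ?h"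
    using card_wide_homs[OF n, of d r, THEN of_nat_mono[where 'a = real]] by simp
  then have "?a / ?h \<le> real (n choose r) ^ 2 / 2 ^ ((2 * d + 1) * r)"
    using h by (simp add: field_simps)
  also have "(2::real) ^ ((2 * d + 1) * r) = 2 powr ((2 * real d + 1) * real r)"
    by (subst powr_realpow[symmetric]) (simp_all add: algebra_simps)
  also have "real (n choose r) ^ 2 / 2 powr ((2 * real d + 1) * real r) =
      real (n choose r) ^ 2 * 2 powr (- ((2 * real d + 1) * real r))"
    unfolding powr_minus divide_inverse ..
  \<comment> \<open>The count yields the exponent \<open>(2 * d + 1) * r\<close>, which is stronger
    than the bound to be shown.\<close>
  also have "\<dots> \<le> real (n choose r) ^ 2 * 2 powr (- ((2 * real d - 1) * real r))"
    by (intro mult_left_mono powr_mono) (auto intro: mult_right_mono)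
  finally show ?thesis by (simp add: prob_uniform_hom[OF n])
qed

lemma prob_narrow:
  assumes n: "n > 0" "even n"
  shows "measure_pmf.prob (uniform_hom n d) {f. card (Rng n f) < 3} \<le> 2 powr (1 - real n / 2)"
proof -
  have "real (card {f \<in> torus_homs n d. card (Rng n f) < 3}) / real (card (torus_homs n d))
      \<le> 2 / 2 ^ (n div 2)"
    using card_narrow_homs[OF n, of d] card_torus_homs_ge[OF n, of d, THEN of_nat_mono[where 'a = real]]
    by (intro frac_le) auto
  also have "\<dots> = 2 powr (1 - real n / 2)"
    using n(2) by (simp add: powr_diff powr_realpow[symmetric] real_of_nat_div)
  finally show ?thesis by (simp add: prob_uniform_hom[OF n])
qed

lemma prob_three_tendsto:
  fixes d :: "nat \<Rightarrow> nat"
  defines "F \<equiv> inf sequentially (principal {n. even n})"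
  assumes "filterlim (\<lambda>n. real (d n) - log 2 (real n)) at_top F"
  shows "((\<lambda>n. measure_pmf.prob (uniform_hom n (d n)) {f. card (Rng n f) = 3}) \<longlongrightarrow> 1) F"
proof (rule tendsto_sandwich)
  have ev: "\<forall>\<^sub>F n in F. n > 0 \<and> even n"
    unfolding F_def eventually_inf_principal using eventually_gt_at_top[of 0]
    by eventually_elim simp
  \<comment> \<open>The subtracted terms bound the probabilities of fewer than three and of at least
    four values. The second is the case \<open>r = 1\<close>, where \<open>n ^ 2\<close> is absorbed
    into the exponent as \<open>2 * log 2 n\<close>.\<close>
  let ?l = "\<lambda>n. 1 - 2 powr (1 - real n / 2) - 2 powr (1 - 2 * (real (d n) - log 2 (real n)))"
  show "\<forall>\<^sub>F n in F. ?l n \<le> measure_pmf.prob (uniform_hom n (d n)) {f. card (Rng n f) = 3}"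
    using ev
  proof eventually_elim
    case (elim n)
    let ?p = "measure_pmf.prob (uniform_hom n (d n))"
    have "UNIV = {f. card (Rng n f) = 3} \<union> {f. card (Rng n f) < 3} \<union> {f. card (Rng n f) \<ge> 3 + 1}"
      by auto
    then have "1 = ?p ({f. card (Rng n f) = 3} \<union> {f. card (Rng n f) < 3} \<union> {f. card (Rng n f) \<ge> 3 + 1})"
      by (metis measure_pmf.prob_space space_measure_pmf)
    also have "\<dots> \<le> ?p ({f. card (Rng n f) = 3} \<union> {f. card (Rng n f) < 3}) + ?p {f. card (Rng n f) \<ge> 3 + 1}"
      by (rule measure_Un_le) auto
    also have "\<dots> \<le> ?p {f. card (Rng n f) = 3} + ?p {f. card (Rng n f) < 3} + ?p {f. card (Rng n f) \<ge> 3 + 1}"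
      by (intro add_right_mono measure_Un_le) auto
    finally have "1 \<le> \<dots>" .
    moreover have "?p {f. card (Rng n f) < 3} \<le> 2 powr (1 - real n / 2)"
      using prob_narrow elim by blast
    moreover have "?p {f. card (Rng n f) \<ge> 3 + 1} \<le> real n ^ 2 * 2 powr (- (2 * real (d n) - 1))"
      using prob_wide[of n "d n" 1] elim by simp
    moreover have "real n ^ 2 * 2 powr (- (2 * real (d n) - 1)) =
        2 powr (1 - 2 * (real (d n) - log 2 (real n)))"
    proof -
      have "real n ^ 2 = 2 powr (2 * log 2 (real n))"
        unfolding mult_2 powr_add power2_eq_square using elim by simp
      then show ?thesis by (simp add: powr_add[symmetric] algebra_simps del: powr_log_cancel)
    qed
    ultimately show ?case by linarith
  qed
  have "((\<lambda>y::real. 2 powr (1 - 2 * y)) \<longlongrightarrow> 0) at_top" by real_asymp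
  then have "((\<lambda>n. 2 powr (1 - 2 * (real (d n) - log 2 (real n)))) \<longlongrightarrow> 0) F"
    using assms(2) by (rule filterlim_compose)
  moreover have "((\<lambda>n. 2 powr (1 - real n / 2)) \<longlongrightarrow> 0) sequentially" by real_asymp
  then have "((\<lambda>n. 2 powr (1 - real n / 2)) \<longlongrightarrow> 0) F"
    unfolding F_def by (rule tendsto_mono[rotated]) simp
  ultimately show "(?l \<longlongrightarrow> 1) F"
    using tendsto_diff[OF tendsto_diff[OF tendsto_const]] by fastforce
  show "\<forall>\<^sub>F n in F. measure_pmf.prob (uniform_hom n (d n)) {f. card (Rng n f) = 3} \<le> 1"
    by (simp add: always_eventually)
qed (rule tendsto_const)

theorem theorem2p6:
  shows "(\<forall>n d r :: nat. n > 0 \<and> even n \<and> d > 0 \<and> r > 0 \<longrightarrow>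
            measure_pmf.prob (uniform_hom n d) {f. card (Rng n f) \<ge> 3 + r}
              \<le> real (n choose r) ^ 2 * 2 powr (- ((2 * real d - 1) * real r)) \<and>
            measure_pmf.prob (uniform_hom n d) {f. card (Rng n f) < 3}
              \<le> 2 powr (1 - real n / 2)) \<and>
         (\<forall>d :: nat \<Rightarrow> nat.
            (\<forall>n. n > 0 \<and> even n \<longrightarrow> d n > 0) \<and>
            filterlim (\<lambda>n. real (d n) - log 2 (real n)) at_top
              (inf sequentially (principal {n. even n})) \<longrightarrow>
            ((\<lambda>n. measure_pmf.prob (uniform_hom n (d n)) {f. card (Rng n f) = 3}) \<longlongrightarrow> 1)
              (inf sequentially (principal {n. even n})))"
  using prob_wide prob_narrow prob_three_tendsto by blast

end
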